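(* Let $n\ge1$ be an integer, $s\in\mathbb{R}$, and let $\theta\in(\frac{2-n}{2},1]$ if $n=1,2$ and $\theta\in[0,1]$ if $n\geq 3$. There exists a constant $C=C_n>0$ such that $$\Vert\Lambda_\theta(t)g\Vert_{H^s(\mathbb{R}^n)}\leq C\,t^{1-\theta}\Vert g\Vert_{H^s(\mathbb{R}^n)}$$ for all $g\in\mathscr{S}(\mathbb{R}^n)$ and $t>0$.
   Context: For $t\geq 0$, $S(t)$ is the Fourier multiplier operator on $\mathbb{R}^n$ with symbol $$m(\xi,t)=e^{-\frac{|\xi|^2t}{2(1+|\xi|^2)}}\,\frac{2(1+|\xi|^2)}{|\xi|^2\sqrt{3+4|\xi|^2}}\,\sin\left(\frac{|\xi|^2\sqrt{3+4|\xi|^2}\,t}{2(1+|\xi|^2)}\right)$$ (equal to $t$ at $\xi=0$), and $\Lambda_\theta(t)=S(t)(I-\Delta)^{-1}(-\Delta)^\theta$, i.e. the Fourier multiplier operator with symbol $m(\xi,t)(1+|\xi|^2)^{-1}|\xi|^{2\theta}$. $\mathscr{S}(\mathbb{R}^n)$ is the Schwartz space and $H^s(\mathbb{R}^n)$ the $L^2$-based Sobolev space. $C_n$ denotes a constant depending only on $n$. *)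

theory Defs
  imports "HOL-Analysis.Analysis"
begin

section \<open>Schwartz functions and tempered distributions on Euclidean space\<close>

definition partial_deriv :: "'n::finite \<Rightarrow> (real^'n \<Rightarrow> complex) \<Rightarrow> real^'n \<Rightarrow> complex" where
  "partial_deriv i f x = frechet_derivative f (at x) (axis i 1)"

text \<open>Lists of coordinate indices play the role of multi-indices; \<open>smooth_fun\<close> below makes the
  order of the entries irrelevant.\<close>

primrec partial_derivs :: "'n::finite list \<Rightarrow> (real^'n \<Rightarrow> complex) \<Rightarrow> real^'n \<Rightarrow> complex" where
  "partial_derivs [] f = f"
| "partial_derivs (i # is) f = partial_deriv i (partial_derivs is f)"

definition smooth_fun :: "(real^'n::finite \<Rightarrow> complex) \<Rightarrow> bool" where
  "smooth_fun f \<longleftrightarrow> (\<forall>is x. partial_derivs is f differentiable (at x))"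

definition schwartz :: "(real^'n::finite \<Rightarrow> complex) set" where
  "schwartz = {f. smooth_fun f \<and>
     (\<forall>k is. bdd_above (range (\<lambda>x. norm x ^ k * cmod (partial_derivs is f x))))}"

definition schwartz_seminorm :: "nat \<Rightarrow> 'n::finite list \<Rightarrow> (real^'n \<Rightarrow> complex) \<Rightarrow> real" where
  "schwartz_seminorm k is f = (SUP x. norm x ^ k * cmod (partial_derivs is f x))"

text \<open>A distribution is a functional of which only the values on \<open>schwartz\<close> matter; continuity
  is expressed through the defining seminorms.\<close>

definition tempered_distribution :: "((real^'n::finite \<Rightarrow> complex) \<Rightarrow> complex) \<Rightarrow> bool" where
  "tempered_distribution u \<longleftrightarrow>
     (\<forall>\<phi>\<in>schwartz. \<forall>\<psi>\<in>schwartz. u (\<lambda>x. \<phi> x + \<psi> x) = u \<phi> + u \<psi>) \<and>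
     (\<forall>c. \<forall>\<phi>\<in>schwartz. u (\<lambda>x. c * \<phi> x) = c * u \<phi>) \<and>
     (\<exists>B N. \<forall>\<phi>\<in>schwartz.
        cmod (u \<phi>) \<le> B * (\<Sum>k\<le>N. \<Sum>is\<in>{is. length is \<le> N}. schwartz_seminorm k is \<phi>))"

definition distribution_of :: "(real^'n::finite \<Rightarrow> complex) \<Rightarrow> (real^'n \<Rightarrow> complex) \<Rightarrow> complex" where
  "distribution_of f \<phi> = (\<integral>x. f x * \<phi> x \<partial>lborel)"

section \<open>Fourier transform and Fourier multipliers\<close>

text \<open>Unitary normalization. The phase has no factor \<open>2 * pi\<close>, so that the Laplacian has
  symbol \<open>- (norm \<xi>)\<^sup>2\<close>.\<close>

definition fourier :: "(real^'n::finite \<Rightarrow> complex) \<Rightarrow> real^'n \<Rightarrow> complex" where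
  "fourier f \<xi> = complex_of_real ((2 * pi) powr (- real CARD('n) / 2)) *
     (\<integral>x. cis (- (x \<bullet> \<xi>)) * f x \<partial>lborel)"

definition inv_fourier :: "(real^'n::finite \<Rightarrow> complex) \<Rightarrow> real^'n \<Rightarrow> complex" where
  "inv_fourier f x = complex_of_real ((2 * pi) powr (- real CARD('n) / 2)) *
     (\<integral>\<xi>. cis (x \<bullet> \<xi>) * f \<xi> \<partial>lborel)"

definition fourier_multiplier ::
    "(real^'n::finite \<Rightarrow> real) \<Rightarrow> (real^'n \<Rightarrow> complex) \<Rightarrow> real^'n \<Rightarrow> complex" where
  "fourier_multiplier \<sigma> g = inv_fourier (\<lambda>\<xi>. complex_of_real (\<sigma> \<xi>) * fourier g \<xi>)"

definition distribution_fourier ::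
    "((real^'n::finite \<Rightarrow> complex) \<Rightarrow> complex) \<Rightarrow> (real^'n \<Rightarrow> complex) \<Rightarrow> complex" where
  "distribution_fourier u \<phi> = u (fourier \<phi>)"

section \<open>Sobolev spaces\<close>

text \<open>\<open>sobolev_density s u v\<close>: the distributional Fourier transform of \<open>u\<close> is the function \<open>v\<close>,
  and \<open>v\<close> is square integrable with weight \<open>(1 + (norm \<xi>)\<^sup>2) powr s\<close>. Such a \<open>v\<close> is unique
  almost everywhere, so the choice in \<open>sobolev_norm\<close> is immaterial for \<open>u\<close> in the space.\<close>

definition sobolev_density ::
    "real \<Rightarrow> ((real^'n::finite \<Rightarrow> complex) \<Rightarrow> complex) \<Rightarrow> (real^'n \<Rightarrow> complex) \<Rightarrow> bool" where
  "sobolev_density s u v \<longleftrightarrow>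
     v \<in> borel_measurable lborel \<and>
     integrable lborel (\<lambda>\<xi>. (1 + (norm \<xi>)\<^sup>2) powr s * (cmod (v \<xi>))\<^sup>2) \<and>
     (\<forall>\<phi>\<in>schwartz. distribution_fourier u \<phi> = distribution_of v \<phi>)"

definition sobolev_space :: "real \<Rightarrow> ((real^'n::finite \<Rightarrow> complex) \<Rightarrow> complex) set" where
  "sobolev_space s = {u. tempered_distribution u \<and> (\<exists>v. sobolev_density s u v)}"

definition sobolev_norm :: "real \<Rightarrow> ((real^'n::finite \<Rightarrow> complex) \<Rightarrow> complex) \<Rightarrow> real" where
  "sobolev_norm s u = (let v = (SOME v. sobolev_density s u v) in
     sqrt (\<integral>\<xi>. (1 + (norm \<xi>)\<^sup>2) powr s * (cmod (v \<xi>))\<^sup>2 \<partial>lborel))"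

section \<open>The operators\<close>

definition m_symbol :: "real \<Rightarrow> real^'n::finite \<Rightarrow> real" where
  "m_symbol t \<xi> = (if \<xi> = 0 then t else
     exp (- ((norm \<xi>)\<^sup>2 * t) / (2 * (1 + (norm \<xi>)\<^sup>2))) *
     (2 * (1 + (norm \<xi>)\<^sup>2) / ((norm \<xi>)\<^sup>2 * sqrt (3 + 4 * (norm \<xi>)\<^sup>2))) *
     sin ((norm \<xi>)\<^sup>2 * sqrt (3 + 4 * (norm \<xi>)\<^sup>2) * t / (2 * (1 + (norm \<xi>)\<^sup>2))))"

text \<open>The case distinction is there because \<open>0 powr 0 = 0\<close>.\<close>

definition frac_laplace_symbol :: "real \<Rightarrow> real^'n::finite \<Rightarrow> real" where
  "frac_laplace_symbol \<theta> \<xi> = (if \<theta> = 0 then 1 else norm \<xi> powr (2 * \<theta>))"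

definition Lambda_op :: "real \<Rightarrow> real \<Rightarrow> (real^'n::finite \<Rightarrow> complex) \<Rightarrow> real^'n \<Rightarrow> complex" where
  "Lambda_op \<theta> t = fourier_multiplier
     (\<lambda>\<xi>. m_symbol t \<xi> * inverse (1 + (norm \<xi>)\<^sup>2) * frac_laplace_symbol \<theta> \<xi>)"

end

theory Submission
  imports Defs "HOL-Probability.Probability"
begin

text \<open>Since \<open>\<bar>sin x\<bar> \<le> x powr (1 - \<theta>)\<close> for \<open>x > 0\<close>, all powers of \<open>norm \<xi>\<close> in the symbol of
  \<open>\<Lambda>\<^sub>\<theta>(t)\<close> cancel except for a factor at most 1, so the symbol is bounded by
  \<open>2 * t powr (1 - \<theta>)\<close> and the estimate follows on the Fourier side. Identifying the Sobolev norms
  with weighted \<open>L\<^sup>2\<close> norms of the expected densities takes Fourier inversion for Schwartz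
  functions (Gaussian regularization), the rapid decay of their transforms, and almost everywhere
  uniqueness of the density, which is obtained by testing with Gaussians.\<close>

section \<open>Gaussian integrals and Fourier inversion\<close>

text \<open>The factor \<open>norm \<xi> powr (2 * \<theta>)\<close> may fail to be smooth at the
  origin, so \<open>Lambda_op \<theta> t g\<close> need not be a Schwartz function and its transform
  is never computed pointwise. Instead, the identity defining \<open>sobolev_density\<close> is
  checked against a test function \<phi>: the inverse transform is moved onto
  \<open>fourier \<phi>\<close>, and only \<phi> has to be inverted. The class used on the Fourier
  side is that of measurable functions of rapid decay, which bounded measurable symbols preserve.

  The norm picks its density by \<open>SOME\<close>, so its value is accessible only once two
  densities are known to agree almost everywhere. Two obstacles stand in the way: equality is given
  only against Schwartz functions, and densities are only square integrable with a weight, hence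
  possibly not integrable. Gaussians meet both. Their derivatives are polynomials times the same
  Gaussian, which makes them explicit Schwartz functions; multiplying by one turns a density into an
  integrable function; and they form the approximate identity that also yields the inversion
  formula.\<close>

lemma cis_measurable [measurable]: "cis \<in> borel_measurable borel"
  by (intro borel_measurable_continuous_onI continuous_intros)

text \<open>\<open>lborel\<close> is the image of a product of one-dimensional Lebesgue measures
  under the coordinate map. This reduces both Gaussians and the majorant \<open>decay\<close> to
  integrals over the line.\<close>

lemma
  fixes f :: "'a::euclidean_space \<Rightarrow> real \<Rightarrow> 'b::{real_normed_field,banach,second_countable_topology}"
  assumes f: "\<And>b. b \<in> Basis \<Longrightarrow> integrable lborel (f b)"
  shows integrable_lborel_prod_Basis: "integrable lborel (\<lambda>x. \<Prod>b\<in>Basis. f b (x \<bullet> b))"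
    and integral_lborel_prod_Basis:
      "(\<integral>x. (\<Prod>b\<in>Basis. f b (x \<bullet> b)) \<partial>lborel) = (\<Prod>b\<in>Basis. \<integral>t. f b t \<partial>lborel)"
proof -
  interpret product_sigma_finite "\<lambda>_::'a. lborel :: real measure" ..
  have [measurable]: "f b \<in> borel_measurable borel" if "b \<in> Basis" for b
    using f[OF that] by auto
  have m: "(\<lambda>x. \<Prod>b\<in>Basis. f b (x \<bullet> b)) \<in> borel_measurable borel"
    by measurable
  have i: "(\<lambda>h. \<Sum>b\<in>Basis. h b *\<^sub>R b) \<in> measurable (\<Pi>\<^sub>M b\<in>Basis. lborel) (borel :: 'a measure)"
    by measurable
  have e: "(\<Prod>b\<in>Basis. f b ((\<Sum>c\<in>Basis. h c *\<^sub>R c) \<bullet> b)) = (\<Prod>b\<in>Basis. f b (h b))" for h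
    by (intro prod.cong) (auto simp: inner_sum_left inner_Basis if_distrib cong: if_cong)
  show "integrable lborel (\<lambda>x. \<Prod>b\<in>Basis. f b (x \<bullet> b))"
    by (subst lborel_eq) (simp add: integrable_distr_eq[OF i m] e product_integrable_prod f)
  show "(\<integral>x. (\<Prod>b\<in>Basis. f b (x \<bullet> b)) \<partial>lborel) = (\<Prod>b\<in>Basis. \<integral>t. f b t \<partial>lborel)"
    by (subst (1) lborel_eq) (simp add: integral_distr[OF i m] e product_integral_prod f)
qed

lemma
  fixes f :: "'a::euclidean_space \<Rightarrow> 'b::{banach,second_countable_topology}"
  assumes c: "c \<noteq> 0" and f: "integrable lborel f"
  shows integrable_lborel_affine: "integrable lborel (\<lambda>x. f (t + c *\<^sub>R x))"
    and integral_lborel_affine: "(\<integral>x. f (t + c *\<^sub>R x) \<partial>lborel) = (\<integral>x. f x \<partial>lborel) /\<^sub>R \<bar>c\<bar> ^ DIM('a)"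
proof -
  have [measurable]: "f \<in> borel_measurable borel"
    using f by auto
  have "integrable (density (distr lborel borel (\<lambda>x. t + c *\<^sub>R x)) (\<lambda>_. \<bar>c\<bar>^DIM('a))) f"
    by (subst lborel_affine[OF c, symmetric]) (rule f)
  then have i: "integrable lborel (\<lambda>x. \<bar>c\<bar>^DIM('a) *\<^sub>R f (t + c *\<^sub>R x))"
    by (subst (asm) integrable_density) (auto simp: integrable_distr_eq)
  have "integrable lborel (\<lambda>x. inverse (\<bar>c\<bar>^DIM('a)) *\<^sub>R (\<bar>c\<bar>^DIM('a) *\<^sub>R f (t + c *\<^sub>R x)))"
    by (rule integrable_scaleR_right) (rule i)
  moreover have "(\<lambda>x. inverse (\<bar>c\<bar>^DIM('a)) *\<^sub>R (\<bar>c\<bar>^DIM('a) *\<^sub>R f (t + c *\<^sub>R x))) = (\<lambda>x. f (t + c *\<^sub>R x))"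
    using c by (simp add: fun_eq_iff)
  ultimately show "integrable lborel (\<lambda>x. f (t + c *\<^sub>R x))"
    by simp
  have "(\<integral>x. f x \<partial>lborel) = (\<integral>x. f x \<partial>density (distr lborel borel (\<lambda>x. t + c *\<^sub>R x)) (\<lambda>_. \<bar>c\<bar>^DIM('a)))"
    by (subst lborel_affine[OF c, symmetric]) (rule refl)
  also have "\<dots> = (\<integral>x. \<bar>c\<bar>^DIM('a) *\<^sub>R f (t + c *\<^sub>R x) \<partial>lborel)"
    by (subst integral_density) (auto simp: integral_distr)
  finally show "(\<integral>x. f (t + c *\<^sub>R x) \<partial>lborel) = (\<integral>x. f x \<partial>lborel) /\<^sub>R \<bar>c\<bar> ^ DIM('a)"
    using c by simp
qed

definition gauss :: "'a::euclidean_space \<Rightarrow> real" where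
  "gauss x = exp (- (norm x)\<^sup>2 / 2)"

lemma gauss_pos: "gauss x > 0" and gauss_le_1: "gauss x \<le> 1"
  by (auto simp: gauss_def)

lemma gauss_measurable [measurable]: "gauss \<in> borel_measurable borel"
  unfolding gauss_def by measurable

lemma gauss_prod: "gauss x = (\<Prod>b\<in>Basis. exp (- (x \<bullet> b)\<^sup>2 / 2))"
proof -
  have "(norm x)\<^sup>2 = (\<Sum>b\<in>Basis. (x \<bullet> b)\<^sup>2)"
    unfolding norm_eq_sqrt_inner by (subst euclidean_inner) (simp add: power2_eq_square sum_nonneg)
  then show ?thesis
    by (simp add: gauss_def exp_sum[symmetric] sum_divide_distrib sum_negf)
qed

text \<open>Up to the factor \<open>sqrt (2 * pi)\<close>, this is the characteristic function of
  the standard normal distribution.\<close>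

lemma gauss_char_1d:
  "integrable lborel (\<lambda>x::real. cis (t * x) * complex_of_real (exp (- x\<^sup>2 / 2)))" (is ?I)
  "(\<integral>x. cis (t * x) * complex_of_real (exp (- x\<^sup>2 / 2)) \<partial>lborel) = complex_of_real (sqrt (2 * pi) * exp (- t\<^sup>2 / 2))"
proof -
  have n: "integrable lborel (\<lambda>x::real. sqrt (2 * pi) * std_normal_density x)"
    by (intro integrable_mult_right integrable_normal_density) simp
  have e: "exp (- x\<^sup>2 / 2) = sqrt (2 * pi) * std_normal_density x" for x
    by (simp add: std_normal_density_def)
  show ?I
    by (rule Bochner_Integration.integrable_bound[OF n]) (auto simp: std_normal_density_def norm_mult)
  have "(\<integral>x. cis (t * x) * complex_of_real (exp (- x\<^sup>2 / 2)) \<partial>lborel)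
      = sqrt (2 * pi) * (\<integral>x. std_normal_density x *\<^sub>R cis (t * x) \<partial>lborel)"
    unfolding e by (subst integral_mult_right_zero[symmetric]) (simp add: scaleR_conv_of_real mult_ac)
  also have "(\<integral>x. std_normal_density x *\<^sub>R cis (t * x) \<partial>lborel) = char std_normal_distribution t"
    unfolding char_def by (subst integral_density) (auto simp: cis_conv_exp)
  finally show "(\<integral>x. cis (t * x) * complex_of_real (exp (- x\<^sup>2 / 2)) \<partial>lborel) = complex_of_real (sqrt (2 * pi) * exp (- t\<^sup>2 / 2))"
    by (simp add: char_std_normal_distribution)
qed

lemma cis_sum: "finite A \<Longrightarrow> cis (sum f A) = (\<Prod>a\<in>A. cis (f a))"
  by (induction A rule: finite_induct) (auto simp: cis_mult[symmetric])

lemma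
  fixes z :: "'a::euclidean_space"
  shows integrable_gauss_cis: "integrable lborel (\<lambda>x::'a. cis (z \<bullet> x) * gauss x)" (is ?I)
    and integral_gauss_cis:
      "(\<integral>x. cis (z \<bullet> x) * gauss x \<partial>lborel) = complex_of_real ((2 * pi) powr (DIM('a) / 2) * gauss z)"
proof -
  have e: "cis (z \<bullet> x) * gauss x = (\<Prod>b\<in>Basis. cis ((z \<bullet> b) * (x \<bullet> b)) * complex_of_real (exp (- (x \<bullet> b)\<^sup>2 / 2)))" for x
    by (subst euclidean_inner) (simp add: cis_sum gauss_prod prod.distrib)
  show ?I
    unfolding e by (rule integrable_lborel_prod_Basis, rule gauss_char_1d)
  have "(\<integral>x. cis (z \<bullet> x) * gauss x \<partial>lborel) = (\<Prod>b\<in>(Basis::'a set). complex_of_real (sqrt (2 * pi) * exp (- (z \<bullet> b)\<^sup>2 / 2)))"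
    unfolding e by (subst integral_lborel_prod_Basis) (simp_all only: gauss_char_1d)
  also have "\<dots> = complex_of_real (sqrt (2 * pi) ^ DIM('a) * gauss z)"
    by (simp add: gauss_prod prod.distrib)
  also have "sqrt (2 * pi) ^ DIM('a) = (2 * pi) powr (DIM('a) / 2)"
    by (simp add: powr_half_sqrt[symmetric] powr_realpow[symmetric] powr_powr)
  finally show "(\<integral>x. cis (z \<bullet> x) * gauss x \<partial>lborel) = complex_of_real ((2 * pi) powr (DIM('a) / 2) * gauss z)" .
qed

lemma integrable_gauss: "integrable lborel (gauss :: 'a::euclidean_space \<Rightarrow> real)"
proof -
  have "integrable lborel (\<lambda>x::'a. Re (cis (0 \<bullet> x) * gauss x))"
    by (rule integrable_Re[OF integrable_gauss_cis])
  then show ?thesis by simp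
qed

lemma integral_gauss: "(\<integral>x. gauss x \<partial>(lborel :: 'a::euclidean_space measure)) = (2 * pi) powr (DIM('a) / 2)"
proof -
  have "complex_of_real (\<integral>x. gauss x \<partial>(lborel :: 'a measure)) = complex_of_real ((2 * pi) powr (DIM('a) / 2))"
    using integral_gauss_cis[of "0::'a"] by (simp add: gauss_def)
  then show ?thesis
    by (simp only: of_real_eq_iff)
qed

text \<open>The bound on the kernel leaves a product of two integrable functions as majorant on the
  product space. The kernels used later are phases and Gaussians.\<close>

lemma Fubini_bounded_kernel:
  fixes f :: "'a::euclidean_space \<Rightarrow> complex" and g :: "'b::euclidean_space \<Rightarrow> complex"
  assumes f: "integrable lborel f" and g: "integrable lborel g"
    and K [measurable]: "(\<lambda>(x, y). K x y) \<in> borel_measurable (borel \<Otimes>\<^sub>M borel)"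
    and K1: "\<And>x y. cmod (K x y) \<le> 1"
  shows "(\<integral>y. (\<integral>x. K x y * f x \<partial>lborel) * g y \<partial>lborel) = (\<integral>x. f x * (\<integral>y. K x y * g y \<partial>lborel) \<partial>lborel)"
proof -
  have [measurable]: "f \<in> borel_measurable borel" "g \<in> borel_measurable borel"
    using f g by auto
  have b: "cmod (K x y * w) \<le> cmod w" for x y w
    using K1[of x y] by (simp add: norm_mult mult_left_le_one_le)
  have bg: "integrable lborel (\<lambda>y. K x y * g y)" for x
    by (rule Bochner_Integration.integrable_bound[OF g]) (auto simp: b)
  have "integrable (lborel \<Otimes>\<^sub>M lborel) (\<lambda>(x, y). f x * g y)"
    by (rule lborel_pair.Fubini_integrable)
       (use f g in \<open>auto simp: norm_mult\<close>)
  then have "integrable (lborel \<Otimes>\<^sub>M lborel) (\<lambda>(x, y). K x y * (f x * g y))"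
    by (rule Bochner_Integration.integrable_bound) (auto simp: b split: prod.split)
  from lborel_pair.Fubini_integral[OF this]
  have "(\<integral>y. (\<integral>x. K x y * f x * g y \<partial>lborel) \<partial>lborel) = (\<integral>x. (\<integral>y. f x * (K x y * g y) \<partial>lborel) \<partial>lborel)"
    by (simp add: mult_ac)
  then show ?thesis by simp
qed

lemma gauss_minus [simp]: "gauss (- x) = gauss x"
  by (simp add: gauss_def)

lemma
  fixes z :: "'a::euclidean_space"
  assumes c: "c > 0"
  shows integrable_gauss_scaled: "integrable lborel (\<lambda>x::'a. cis (z \<bullet> x) * gauss (c *\<^sub>R x))"
    and integral_gauss_scaled:
      "(\<integral>x. cis (z \<bullet> x) * gauss (c *\<^sub>R x) \<partial>lborel) =
         complex_of_real ((2 * pi) powr (DIM('a) / 2) * gauss (z /\<^sub>R c) / c ^ DIM('a))"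
proof -
  have nz: "c \<noteq> 0" using c by simp
  have "(z /\<^sub>R c) \<bullet> (c *\<^sub>R x) = z \<bullet> x" for x :: 'a
    using nz by simp
  then have e: "cis ((z /\<^sub>R c) \<bullet> (0 + c *\<^sub>R x)) * complex_of_real (gauss (0 + c *\<^sub>R x))
      = cis (z \<bullet> x) * complex_of_real (gauss (c *\<^sub>R x))" for x
    by (simp del: inner_scaleR_left inner_scaleR_right)
  show "integrable lborel (\<lambda>x::'a. cis (z \<bullet> x) * gauss (c *\<^sub>R x))"
    using integrable_lborel_affine[OF nz integrable_gauss_cis, of "z /\<^sub>R c" 0] unfolding e .
  have "(\<integral>x. cis (z \<bullet> x) * gauss (c *\<^sub>R x) \<partial>lborel) =
      complex_of_real ((2 * pi) powr (DIM('a) / 2) * gauss (z /\<^sub>R c)) /\<^sub>R \<bar>c\<bar> ^ DIM('a)"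
    using integral_lborel_affine[OF nz integrable_gauss_cis, of "z /\<^sub>R c" 0]
    unfolding e by (simp only: integral_gauss_cis)
  then show "(\<integral>x. cis (z \<bullet> x) * gauss (c *\<^sub>R x) \<partial>lborel) =
         complex_of_real ((2 * pi) powr (DIM('a) / 2) * gauss (z /\<^sub>R c) / c ^ DIM('a))"
    using c by (simp only: scaleR_conv_of_real of_real_mult[symmetric] abs_of_pos divide_inverse mult.commute)
qed

text \<open>In this rescaled form the Gaussian weight does not depend on \<open>k\<close>, so
  dominated convergence applies. Continuity enters only at the point \<open>y\<close>, which admits
  indicator functions of boxes.\<close>

lemma gauss_average_tendsto:
  fixes f :: "'a::euclidean_space \<Rightarrow> complex"
  assumes [measurable]: "f \<in> borel_measurable borel"
    and B: "\<And>x. cmod (f x) \<le> B" and f: "isCont f y" and e: "e \<longlonglongrightarrow> 0"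
  shows "(\<lambda>k. \<integral>z. f (y + e k *\<^sub>R z) * gauss z \<partial>lborel) \<longlonglongrightarrow> f y * (2 * pi) powr (DIM('a) / 2)"
proof -
  have "(\<lambda>k. \<integral>z. f (y + e k *\<^sub>R z) * gauss z \<partial>lborel) \<longlonglongrightarrow> (\<integral>z. f y * gauss (z::'a) \<partial>lborel)"
  proof (rule integral_dominated_convergence[where w="\<lambda>z::'a. B * gauss z"])
    show "integrable lborel (\<lambda>z::'a. B * gauss z)"
      by (intro integrable_mult_right integrable_gauss)
    show "AE z in lborel. (\<lambda>k. f (y + e k *\<^sub>R z) * complex_of_real (gauss z)) \<longlonglongrightarrow> f y * complex_of_real (gauss z)"
    proof (intro AE_I2 tendsto_intros)
      fix z
      have "(\<lambda>k. y + e k *\<^sub>R z) \<longlonglongrightarrow> y + 0 *\<^sub>R z"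
        by (intro tendsto_intros e)
      then show "(\<lambda>k. f (y + e k *\<^sub>R z)) \<longlonglongrightarrow> f y"
        by (intro isCont_tendsto_compose[OF f]) simp
    qed
    show "AE z in lborel. cmod (f (y + e k *\<^sub>R z) * complex_of_real (gauss z)) \<le> B * gauss z" for k
      by (auto simp: norm_mult abs_of_pos[OF gauss_pos] less_imp_le[OF gauss_pos] intro!: mult_right_mono B)
  qed auto
  then show ?thesis
    by (simp add: integral_gauss)
qed

text \<open>The double integral over \<xi> and y in general lacks absolute convergence. The factor
  \<open>gauss (e k *\<^sub>R \<xi>)\<close> restores it; exchanging the integrals then gives a
  Gaussian average of \<open>f\<close> around \<open>x\<close>. Integrability of the transform lets
  the factor be removed in the limit.\<close>

lemma fourier_inversion_unnormalized:
  fixes f :: "'a::euclidean_space \<Rightarrow> complex"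
  assumes f: "integrable lborel f" and B: "\<And>x. cmod (f x) \<le> B" and cont: "isCont f x"
    and F: "integrable lborel (\<lambda>\<xi>. \<integral>y. cis (- (y \<bullet> \<xi>)) * f y \<partial>lborel)"
  shows "(\<integral>\<xi>. cis (x \<bullet> \<xi>) * (\<integral>y. cis (- (y \<bullet> \<xi>)) * f y \<partial>lborel) \<partial>lborel) = (2 * pi) powr DIM('a) * f x"
proof -
  define F where "F \<xi> = (\<integral>y. cis (- (y \<bullet> \<xi>)) * f y \<partial>lborel)" for \<xi>
  define c where "c = (2 * pi) powr (DIM('a) / 2)"
  define e :: "nat \<Rightarrow> real" where "e k = inverse (real (Suc k))" for k
  have e0: "e k > 0" for k
    by (simp add: e_def)
  have e: "e \<longlonglongrightarrow> 0"
    unfolding e_def by (rule LIMSEQ_inverse_real_of_nat)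
  have [measurable]: "f \<in> borel_measurable borel" "F \<in> borel_measurable borel"
    using f F unfolding F_def[symmetric] by auto
  let ?A = "\<lambda>k. \<integral>\<xi>. F \<xi> * (cis (x \<bullet> \<xi>) * gauss (e k *\<^sub>R \<xi>)) \<partial>lborel"
  have "?A \<longlonglongrightarrow> (\<integral>\<xi>. F \<xi> * cis (x \<bullet> \<xi>) \<partial>lborel)"
  proof (rule integral_dominated_convergence[where w="\<lambda>\<xi>. cmod (F \<xi>)"])
    show "integrable lborel (\<lambda>\<xi>. cmod (F \<xi>))"
      using F unfolding F_def[symmetric] by auto
    show "AE \<xi> in lborel. (\<lambda>k. F \<xi> * (cis (x \<bullet> \<xi>) * complex_of_real (gauss (e k *\<^sub>R \<xi>)))) \<longlonglongrightarrow> F \<xi> * cis (x \<bullet> \<xi>)"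
    proof (intro AE_I2 tendsto_mult[OF tendsto_const])
      fix \<xi> :: 'a
      have "isCont (\<lambda>r. cis (x \<bullet> \<xi>) * complex_of_real (gauss (r *\<^sub>R \<xi>))) 0"
        unfolding gauss_def by (intro continuous_intros) auto
      from isCont_tendsto_compose[OF this e]
      show "(\<lambda>k. cis (x \<bullet> \<xi>) * complex_of_real (gauss (e k *\<^sub>R \<xi>))) \<longlonglongrightarrow> cis (x \<bullet> \<xi>)"
        by (simp add: gauss_def)
    qed
    show "AE \<xi> in lborel. cmod (F \<xi> * (cis (x \<bullet> \<xi>) * complex_of_real (gauss (e k *\<^sub>R \<xi>)))) \<le> cmod (F \<xi>)" for k
      by (auto simp: norm_mult abs_of_pos[OF gauss_pos] intro!: mult_left_le gauss_le_1)
  qed auto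
  moreover have "?A = (\<lambda>k. c * (\<integral>z. f (x + e k *\<^sub>R z) * gauss z \<partial>lborel))"
  proof
    fix k
    show "?A k = c * (\<integral>z. f (x + e k *\<^sub>R z) * gauss z \<partial>lborel)"
    proof -
      note ek = e0[of k]
      have i: "integrable lborel (\<lambda>y. f y * gauss ((x - y) /\<^sub>R e k))"
        by (rule Bochner_Integration.integrable_bound[OF f])
           (auto simp: norm_mult abs_of_pos[OF gauss_pos] intro!: mult_left_le gauss_le_1)
      have "?A k = (\<integral>y. f y * (\<integral>\<xi>. cis (- (y \<bullet> \<xi>)) * (cis (x \<bullet> \<xi>) * gauss (e k *\<^sub>R \<xi>)) \<partial>lborel) \<partial>lborel)"
        unfolding F_def by (rule Fubini_bounded_kernel[OF f integrable_gauss_scaled[OF ek]]) auto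
      also have "\<dots> = (\<integral>y. f y * (\<integral>\<xi>. cis ((x - y) \<bullet> \<xi>) * gauss (e k *\<^sub>R \<xi>) \<partial>lborel) \<partial>lborel)"
        by (simp only: mult.assoc[symmetric] cis_mult inner_diff_left add_uminus_conv_diff uminus_add_conv_diff)
      also have "\<dots> = (\<integral>y. complex_of_real (c / e k ^ DIM('a)) * (f y * gauss ((x - y) /\<^sub>R e k)) \<partial>lborel)"
        unfolding integral_gauss_scaled[OF ek] c_def[symmetric] by (simp add: mult_ac)
      also have "\<dots> = c * ((\<integral>y. f y * gauss ((x - y) /\<^sub>R e k) \<partial>lborel) /\<^sub>R \<bar>e k\<bar> ^ DIM('a))"
        using ek by (subst integral_mult_right_zero) (simp add: scaleR_conv_of_real divide_inverse mult_ac)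
      also have "(\<integral>y. f y * gauss ((x - y) /\<^sub>R e k) \<partial>lborel) /\<^sub>R \<bar>e k\<bar> ^ DIM('a)
          = (\<integral>z. f (x + e k *\<^sub>R z) * gauss z \<partial>lborel)"
      proof -
        have "(x - (x + e k *\<^sub>R z)) /\<^sub>R e k = - z" for z
          using ek by simp
        then show ?thesis
          using integral_lborel_affine[OF _ i, of "e k" x] ek by simp
      qed
      finally show ?thesis .
    qed
  qed
  ultimately have "(\<lambda>k. c * (\<integral>z. f (x + e k *\<^sub>R z) * gauss z \<partial>lborel)) \<longlonglongrightarrow> (\<integral>\<xi>. F \<xi> * cis (x \<bullet> \<xi>) \<partial>lborel)"
    by (simp only:)
  \<comment> \<open>One factor \<open>c\<close> comes from the transform of the Gaussian, the other
    is the total mass of the Gaussian.\<close>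
  moreover have "(\<lambda>k. c * (\<integral>z. f (x + e k *\<^sub>R z) * gauss z \<partial>lborel)) \<longlonglongrightarrow> complex_of_real c * (f x * complex_of_real c)"
    by (intro tendsto_mult tendsto_const gauss_average_tendsto[OF _ B cont e, folded c_def]) simp
  ultimately have "(\<integral>\<xi>. F \<xi> * cis (x \<bullet> \<xi>) \<partial>lborel) = complex_of_real c * (f x * complex_of_real c)"
    by (rule LIMSEQ_unique)
  also have "\<dots> = complex_of_real (c * c) * f x"
    by simp
  also have "c * c = (2 * pi) powr DIM('a)"
    by (simp add: c_def powr_add[symmetric])
  finally show ?thesis
    unfolding F_def[symmetric] by (subst mult.commute) simp
qed

section \<open>Functions determined by their Gaussian averages\<close>

text \<open>Averaging \<open>w\<close> against Gaussians determines its integral over a box, because the Gaussian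
  averages of the indicator function converge to it off the boundary of the box.\<close>

lemma set_integral_box_eq_0:
  fixes w :: "'a::euclidean_space \<Rightarrow> complex"
  assumes w: "integrable lborel w"
    and z: "\<And>x c. c > 0 \<Longrightarrow> (\<integral>y. gauss ((x - y) /\<^sub>R c) * w y \<partial>lborel) = 0"
  shows "(\<integral>y\<in>box a b. w y \<partial>lborel) = 0"
proof -
  let ?f = "\<lambda>x. complex_of_real (indicator (box a b) x)"
  let ?c = "(2 * pi) powr (DIM('a) / 2)"
  have [measurable]: "w \<in> borel_measurable borel"
    using w by auto
  define e :: "nat \<Rightarrow> real" where "e k = inverse (real (Suc k))" for k
  have e0: "e k > 0" for k
    by (simp add: e_def)
  have e: "e \<longlonglongrightarrow> 0"
    unfolding e_def by (rule LIMSEQ_inverse_real_of_nat)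
  have "emeasure lborel (box a b) < \<infinity>"
    by (rule emeasure_lborel_box_finite)
  then have fi: "integrable lborel ?f"
    by (intro integrable_of_real integrable_real_indicator) auto
  have f1: "cmod (?f x) \<le> 1" for x
    by (auto simp: indicator_def)
  have g1: "cmod (complex_of_real (gauss x)) \<le> 1" for x :: 'a
    using gauss_le_1[of x] gauss_pos[of x] by simp
  let ?A = "\<lambda>k. \<integral>y. (\<integral>z. ?f (y + e k *\<^sub>R z) * gauss z \<partial>lborel) * w y \<partial>lborel"
  \<comment> \<open>Exchanging the integrals moves the Gaussian average from the indicator to
    \<open>w\<close>, where it vanishes by hypothesis.\<close>
  have "?A k = 0" for k
  proof -
    note ek = e0[of k]
    have i: "integrable lborel (\<lambda>x. gauss ((x - y) /\<^sub>R e k) * ?f x)" for y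
      by (rule Bochner_Integration.integrable_bound[OF fi])
         (auto simp: norm_mult abs_of_pos[OF gauss_pos] intro!: mult_left_le_one_le gauss_le_1 less_imp_le[OF gauss_pos])
    have "(\<integral>z. ?f (y + e k *\<^sub>R z) * gauss z \<partial>lborel) = (\<integral>x. gauss ((x - y) /\<^sub>R e k) * ?f x \<partial>lborel) /\<^sub>R e k ^ DIM('a)" for y
      using ek integral_lborel_affine[OF _ i, of "e k" y y] by (simp add: mult.commute)
    then have "?A k = (\<integral>y. ((\<integral>x. gauss ((x - y) /\<^sub>R e k) * ?f x \<partial>lborel) * w y) /\<^sub>R e k ^ DIM('a) \<partial>lborel)"
      by simp
    also have "\<dots> = (\<integral>y. (\<integral>x. gauss ((x - y) /\<^sub>R e k) * ?f x \<partial>lborel) * w y \<partial>lborel) /\<^sub>R e k ^ DIM('a)"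
      by (rule integral_scaleR_right)
    also have "(\<integral>y. (\<integral>x. gauss ((x - y) /\<^sub>R e k) * ?f x \<partial>lborel) * w y \<partial>lborel)
        = (\<integral>x. ?f x * (\<integral>y. gauss ((x - y) /\<^sub>R e k) * w y \<partial>lborel) \<partial>lborel)"
      by (rule Fubini_bounded_kernel[OF fi w _ g1]) measurable
    finally show ?thesis
      by (simp add: z[OF ek])
  qed
  moreover have "?A \<longlonglongrightarrow> (\<integral>y. (?f y * ?c) * w y \<partial>lborel)"
  proof (rule integral_dominated_convergence[where w="\<lambda>y. ?c * cmod (w y)"])
    show "integrable lborel (\<lambda>y. ?c * cmod (w y))"
      using w by auto
    \<comment> \<open>A box is convex, hence its boundary is negligible and its indicator is
      continuous at almost every point.\<close>
    have "frontier (box a b) \<in> null_sets lborel"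
      using negligible_convex_frontier[OF convex_box(2)]
      by (auto simp: negligible_iff_null_sets null_sets_completion_iff)
    then have "AE y in lborel. y \<notin> frontier (box a b)"
      by (rule AE_not_in)
    then show "AE y in lborel. (\<lambda>k. (\<integral>z. ?f (y + e k *\<^sub>R z) * gauss z \<partial>lborel) * w y) \<longlonglongrightarrow> (?f y * ?c) * w y"
    proof eventually_elim
      case (elim y)
      then have "isCont ?f y"
        by (intro continuous_of_real) (simp add: isCont_indicator)
      then show ?case
        by (intro tendsto_mult tendsto_const gauss_average_tendsto[OF _ f1 _ e]) simp
    qed
    have "cmod (\<integral>z. ?f (y + e k *\<^sub>R z) * gauss z \<partial>lborel) \<le> ?c" for k y
    proof -
      have "cmod (\<integral>z. ?f (y + e k *\<^sub>R z) * gauss z \<partial>lborel) \<le> (\<integral>z. gauss (z::'a) \<partial>lborel)"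
        by (rule order.trans[OF integral_norm_bound integral_mono'])
           (auto simp: indicator_def norm_mult abs_of_pos[OF gauss_pos] less_imp_le[OF gauss_pos] integrable_gauss)
      also have "\<dots> = ?c"
        using integral_gauss[where 'a='a] by (metis integral_complex_of_real of_real_eq_iff)
      finally show ?thesis .
    qed
    then show "AE y in lborel. cmod ((\<integral>z. ?f (y + e k *\<^sub>R z) * gauss z \<partial>lborel) * w y) \<le> ?c * cmod (w y)" for k
      by (auto simp: norm_mult intro!: mult_right_mono)
  qed auto
  ultimately have "(\<integral>y. (?f y * ?c) * w y \<partial>lborel) = 0"
    by (simp add: LIMSEQ_const_iff)
  also have "(\<lambda>y. (?f y * ?c) * w y) = (\<lambda>y. complex_of_real ?c * (indicator (box a b) y *\<^sub>R w y))"
    by (auto simp: fun_eq_iff indicator_def)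
  finally have "complex_of_real ?c * (\<integral>y. indicator (box a b) y *\<^sub>R w y \<partial>lborel) = 0"
    unfolding integral_mult_right_zero .
  then show ?thesis
    by (simp add: set_lebesgue_integral_def)
qed

text \<open>Boxes form an intersection-stable generator of the Borel sets, and the sets over which
  \<open>w\<close> integrates to 0 are closed under complements and countable disjoint
  unions.\<close>

lemma AE_eq_0_if_box_integrals_eq_0:
  fixes w :: "'a::euclidean_space \<Rightarrow> 'b::{second_countable_topology,banach}"
  assumes w: "integrable lborel w" and z: "\<And>a b. (\<integral>y\<in>box a b. w y \<partial>lborel) = 0"
  shows "AE x in lborel. w x = 0"
proof (rule sigma_finite_measure.density_zero[OF sigma_finite_lborel w])
  let ?E = "range (\<lambda>(a, b). box a b :: 'a set)"
  have si: "set_integrable lborel A w" if "A \<in> sets borel" for A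
    using integrable_mult_indicator[OF _ w] that by (simp add: set_integrable_def)
  \<comment> \<open>The complement case needs the integral over the whole space, obtained as a limit
    over growing boxes.\<close>
  have U: "(\<integral>y\<in>UNIV. w y \<partial>lborel) = 0"
  proof -
    have "(\<lambda>n::nat. \<integral>y\<in>box (- (real n *\<^sub>R One)) (real n *\<^sub>R One). w y \<partial>lborel)
        \<longlonglongrightarrow> (\<integral>y\<in>(\<Union>n::nat. box (- (real n *\<^sub>R One)) (real n *\<^sub>R One)). w y \<partial>lborel)"
      by (rule set_integral_cont_up)
         (auto simp: incseq_def subset_box UN_box_eq_UNIV intro!: si)
    then show ?thesis
      by (simp add: z UN_box_eq_UNIV LIMSEQ_const_iff)
  qed
  fix A :: "'a set" assume "A \<in> sets lborel"
  then have "A \<in> sigma_sets UNIV ?E"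
    by (simp add: borel_eq_box)
  have "Int_stable ?E" "?E \<subseteq> Pow UNIV"
    by (auto simp: Int_stable_def box_Int_box)
  from this \<open>A \<in> sigma_sets UNIV ?E\<close> show "(\<integral>y\<in>A. w y \<partial>lborel) = 0"
  proof (induction rule: sigma_sets_induct_disjoint)
    case (compl A)
    then have A: "A \<in> sets borel"
      by (simp add: borel_eq_box)
    have "(\<integral>y\<in>A \<union> (UNIV - A). w y \<partial>lborel) = (\<integral>y\<in>A. w y \<partial>lborel) + (\<integral>y\<in>UNIV - A. w y \<partial>lborel)"
      using A by (intro set_integral_Un si) auto
    then show ?case
      using compl U by simp
  next
    case (union A)
    then have A: "A i \<in> sets borel" for i
      using range_subsetD[OF union(2), of i] by (simp add: borel_eq_box)
    have "(\<integral>y\<in>(\<Union>i. A i). w y \<partial>lborel) = (\<Sum>i. \<integral>y\<in>A i. w y \<partial>lborel)"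
      using A union by (intro lebesgue_integral_countable_add si) (auto simp: disjoint_family_on_def)
    then show ?case
      using union by simp
  qed (use z in \<open>auto simp: set_lebesgue_integral_def\<close>)
qed

section \<open>Rapidly decreasing functions and Schwartz functions\<close>

text \<open>A majorant in product form: its integrability reduces to that of
  \<open>inverse (1 + t\<^sup>2)\<close> on the line.\<close>

definition decay :: "'a::euclidean_space \<Rightarrow> real" where
  "decay x = (\<Prod>b\<in>Basis. inverse (1 + (x \<bullet> b)\<^sup>2))"

lemma decay_pos: "decay x > 0"
  unfolding decay_def by (intro prod_pos) (auto simp: add_pos_nonneg)

lemma integrable_decay: "integrable lborel (decay :: 'a::euclidean_space \<Rightarrow> real)"
proof -
  have "integrable lborel (\<lambda>t::real. inverse (1 + t\<^sup>2))"
    using integrable_inverse_1_plus_square by (simp add: set_integrable_def)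
  then show ?thesis
    unfolding decay_def by (rule integrable_lborel_prod_Basis)
qed

lemma power_1_plus_le: "(1 + u) ^ n \<le> 2 ^ n * (1 + u ^ n)" if "u \<ge> 0" for u :: real
proof -
  have "(1 + u) ^ n \<le> (2 * max 1 u) ^ n"
    using that by (intro power_mono) auto
  also have "\<dots> = 2 ^ n * max 1 u ^ n"
    by (rule power_mult_distrib)
  also have "max 1 u ^ n \<le> 1 + u ^ n"
    using that by (auto simp: max_def)
  finally show ?thesis by simp
qed

text \<open>The reciprocal of \<open>decay\<close> grows at most like a polynomial of degree
  \<open>2 * DIM('a)\<close>. Multiplied by \<open>cmod (f x)\<close>, the inequality bounds
  \<open>f\<close> by a multiple of \<open>decay\<close> through its weighted suprema for the
  exponents 0 and \<open>2 * DIM('a)\<close>.\<close>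

lemma one_le_decay_mult: "1 \<le> decay x * (2 ^ DIM('a) * (1 + norm x ^ (2 * DIM('a))))" for x :: "'a::euclidean_space"
proof -
  have "inverse (decay x) = (\<Prod>b\<in>Basis. 1 + (x \<bullet> b)\<^sup>2)"
    using prod_inversef[of "\<lambda>b. 1 + (x \<bullet> b)\<^sup>2" Basis] by (simp add: decay_def o_def)
  also have "\<dots> \<le> (\<Prod>b\<in>(Basis::'a set). 1 + (norm x)\<^sup>2)"
  proof (rule prod_mono)
    fix b :: 'a assume "b \<in> Basis"
    then have "\<bar>x \<bullet> b\<bar> \<le> norm x" by (rule Basis_le_norm)
    then have "(x \<bullet> b)\<^sup>2 \<le> (norm x)\<^sup>2"
      by (simp add: abs_le_square_iff[symmetric])
    then show "0 \<le> 1 + (x \<bullet> b)\<^sup>2 \<and> 1 + (x \<bullet> b)\<^sup>2 \<le> 1 + (norm x)\<^sup>2"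
      by simp
  qed
  also have "\<dots> = (1 + (norm x)\<^sup>2) ^ DIM('a)"
    by simp
  also have "\<dots> \<le> 2 ^ DIM('a) * (1 + ((norm x)\<^sup>2) ^ DIM('a))"
    by (rule power_1_plus_le) simp
  finally have "inverse (decay x) \<le> 2 ^ DIM('a) * (1 + norm x ^ (2 * DIM('a)))"
    by (simp add: power_mult)
  then have "decay x * inverse (decay x) \<le> decay x * (2 ^ DIM('a) * (1 + norm x ^ (2 * DIM('a))))"
    using decay_pos[of x] by (intro mult_left_mono) auto
  then show ?thesis
    using decay_pos[of x] by simp
qed

text \<open>Serves to dominate difference quotients: there the derivative is evaluated up to
  distance 1 from \<open>x\<close>, while the majorant has to depend on \<open>x\<close>
  alone.\<close>

lemma decay_translate_le:
  fixes a :: "'a::euclidean_space"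
  assumes "norm a \<le> 1"
  shows "decay (x + a) \<le> 3 ^ DIM('a) * decay x"
proof -
  have "decay (x + a) \<le> (\<Prod>b\<in>Basis. 3 * inverse (1 + (x \<bullet> b)\<^sup>2))"
    unfolding decay_def
  proof (rule prod_mono)
    fix b :: 'a assume "b \<in> Basis"
    then have "\<bar>a \<bullet> b\<bar> \<le> 1" using Basis_le_norm[of b a] assms by simp
    then have d: "(a \<bullet> b)\<^sup>2 \<le> 1" by (simp add: abs_square_le_1)
    \<comment> \<open>With u for \<open>x \<bullet> b\<close> and v for
      \<open>a \<bullet> b\<close>, the two sides of the inequality below differ by (2u + 3v)^2 / 2
      + 2 - 3v^2 / 2, which is positive because v^2 is at most 1.\<close>
    have "0 \<le> (2 * (x \<bullet> b) + 3 * (a \<bullet> b))\<^sup>2" by simp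
    with d have "1 + (x \<bullet> b)\<^sup>2 \<le> 3 * (1 + (x \<bullet> b + a \<bullet> b)\<^sup>2)"
      by (simp add: power2_eq_square algebra_simps)
    moreover have "inverse q \<le> 3 * inverse p" if "p \<le> 3 * q" "p > 0" "q > 0" for p q :: real
      using that by (simp add: field_simps)
    ultimately have "inverse (1 + (x \<bullet> b + a \<bullet> b)\<^sup>2) \<le> 3 * inverse (1 + (x \<bullet> b)\<^sup>2)"
      by (simp add: add_pos_nonneg)
    then show "0 \<le> inverse (1 + ((x + a) \<bullet> b)\<^sup>2) \<and> inverse (1 + ((x + a) \<bullet> b)\<^sup>2) \<le> 3 * inverse (1 + (x \<bullet> b)\<^sup>2)"
      by (simp add: inner_add_left add_nonneg_nonneg)
  qed
  then show ?thesis
    by (simp add: prod.distrib decay_def)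
qed

definition rapid :: "('a::euclidean_space \<Rightarrow> complex) \<Rightarrow> bool" where
  "rapid f \<longleftrightarrow> f \<in> borel_measurable borel \<and> (\<forall>k. \<exists>C. \<forall>x. norm x ^ k * cmod (f x) \<le> C)"

lemma rapid_measurable: "rapid f \<Longrightarrow> f \<in> borel_measurable borel"
  by (simp add: rapid_def)

lemma rapid_bounded:
  assumes "rapid f" obtains C where "\<And>x. cmod (f x) \<le> C"
  using assms unfolding rapid_def by (metis mult_1 power_0)

lemma rapid_le_decay:
  fixes f :: "'a::euclidean_space \<Rightarrow> complex"
  assumes "rapid f" obtains C where "\<And>x. cmod (f x) \<le> C * decay x" "C \<ge> 0"
proof -
  obtain A where A: "\<And>x. norm x ^ 0 * cmod (f x) \<le> A"
    using assms unfolding rapid_def by metis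
  obtain B where B: "\<And>x. norm x ^ (2 * DIM('a)) * cmod (f x) \<le> B"
    using assms unfolding rapid_def by metis
  have "cmod (f x) \<le> 2 ^ DIM('a) * (A + B) * decay x" for x
  proof -
    have "1 * cmod (f x) \<le> (decay x * (2 ^ DIM('a) * (1 + norm x ^ (2 * DIM('a))))) * cmod (f x)"
      by (intro mult_right_mono one_le_decay_mult) simp
    also have "\<dots> = (decay x * 2 ^ DIM('a)) * (norm x ^ 0 * cmod (f x) + norm x ^ (2 * DIM('a)) * cmod (f x))"
      by (simp add: algebra_simps)
    also have "\<dots> \<le> (decay x * 2 ^ DIM('a)) * (A + B)"
      using decay_pos[of x] by (intro mult_left_mono add_mono A B) simp
    finally show ?thesis by (simp add: mult_ac)
  qed
  moreover have "0 \<le> A" "0 \<le> B"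
    using A[of 0] B[of 0] by (auto intro: order.trans[rotated])
  ultimately show ?thesis
    by (intro that[of "2 ^ DIM('a) * (A + B)"]) auto
qed

lemma rapid_integrable: "rapid f \<Longrightarrow> integrable lborel f"
proof -
  assume f: "rapid f"
  then obtain C where C: "\<And>x. cmod (f x) \<le> C * decay x" "C \<ge> 0"
    by (rule rapid_le_decay) auto
  have "integrable lborel (\<lambda>x. C * decay x)"
    by (intro integrable_mult_right integrable_decay)
  then show ?thesis
  proof (rule Bochner_Integration.integrable_bound)
    show "f \<in> borel_measurable lborel"
      using f by (simp add: rapid_measurable)
    show "AE x in lborel. cmod (f x) \<le> norm (C * decay x)"
      using C by (auto intro: order.trans[OF _ abs_ge_self])
  qed
qed

lemma rapid_mult:
  assumes f: "rapid f" and h: "h \<in> borel_measurable borel" and A: "\<And>x. cmod (h x) \<le> A * (1 + norm x ^ m)"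
  shows "rapid (\<lambda>x. h x * f x)"
  unfolding rapid_def
proof (intro conjI allI)
  show "(\<lambda>x. h x * f x) \<in> borel_measurable borel"
    using h rapid_measurable[OF f] by simp
  fix k
  obtain C where C: "\<And>x. norm x ^ k * cmod (f x) \<le> C"
    using f unfolding rapid_def by metis
  obtain D where D: "\<And>x. norm x ^ (k + m) * cmod (f x) \<le> D"
    using f unfolding rapid_def by metis
  have A0: "A \<ge> 0"
    using A[of 0] norm_ge_zero[of "h 0"] by (cases "m = 0") (auto simp: power_0_left simp del: norm_ge_zero)
  have "norm x ^ k * cmod (h x * f x) \<le> A * (C + D)" for x
  proof -
    have "norm x ^ k * cmod (h x * f x) \<le> norm x ^ k * (A * (1 + norm x ^ m) * cmod (f x))"
      unfolding norm_mult by (intro mult_left_mono mult_right_mono A) auto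
    also have "\<dots> = A * (norm x ^ k * cmod (f x) + norm x ^ (k + m) * cmod (f x))"
      by (simp add: algebra_simps power_add)
    also have "\<dots> \<le> A * (C + D)"
      by (intro mult_left_mono add_mono C D A0)
    finally show ?thesis .
  qed
  then show "\<exists>C. \<forall>x. norm x ^ k * cmod (h x * f x) \<le> C" by blast
qed

lemma rapid_mult_bounded:
  assumes "rapid f" "h \<in> borel_measurable borel" "\<And>x. cmod (h x) \<le> A"
  shows "rapid (\<lambda>x. h x * f x)"
  \<comment> \<open>For exponent 0 the growth factor \<open>1 + norm x ^ 0\<close> is 2, hence the
    halved constant.\<close>
  using rapid_mult[of f h "A / 2" 0] assms by simp

lemma rapid_weight: "rapid f \<Longrightarrow> rapid (\<lambda>x. complex_of_real ((1 + (norm x)\<^sup>2) powr s) * f x)"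
proof (rule rapid_mult[where A="2 ^ nat \<lceil>s\<rceil>" and m="2 * nat \<lceil>s\<rceil>"])
  fix x :: 'a
  \<comment> \<open>The base is at least 1, so the exponent may be raised to a natural number, which
    is 0 for negative \<open>s\<close>.\<close>
  have "(1 + (norm x)\<^sup>2) powr s \<le> (1 + (norm x)\<^sup>2) powr real (nat \<lceil>s\<rceil>)"
    by (intro powr_mono) (auto simp: real_nat_ceiling_ge)
  also have "\<dots> = (1 + (norm x)\<^sup>2) ^ nat \<lceil>s\<rceil>"
    by (intro powr_realpow) (auto simp: add_pos_nonneg)
  also have "\<dots> \<le> 2 ^ nat \<lceil>s\<rceil> * (1 + ((norm x)\<^sup>2) ^ nat \<lceil>s\<rceil>)"
    by (rule power_1_plus_le) simp
  finally show "cmod (complex_of_real ((1 + (norm x)\<^sup>2) powr s)) \<le> 2 ^ nat \<lceil>s\<rceil> * (1 + norm x ^ (2 * nat \<lceil>s\<rceil>))"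
    by (simp add: power_mult)
qed auto

lemma rapid_integrable_weight:
  assumes f: "rapid f"
  shows "integrable lborel (\<lambda>x. (1 + (norm x)\<^sup>2) powr s * (cmod (f x))\<^sup>2)"
proof -
  obtain C where "\<And>x. cmod (f x) \<le> C"
    using rapid_bounded[OF f] by blast
  moreover have [measurable]: "f \<in> borel_measurable borel"
    using f by (rule rapid_measurable)
  \<comment> \<open>One factor \<open>f\<close> is used only through its bound; the other absorbs
    the weight by its decay.\<close>
  ultimately have "rapid (\<lambda>x. complex_of_real (cmod (f x)) * (complex_of_real ((1 + (norm x)\<^sup>2) powr s) * f x))"
    by (intro rapid_mult_bounded[where A=C] rapid_weight f) auto
  from integrable_norm[OF rapid_integrable[OF this]]
  show ?thesis
    by (simp add: norm_mult power2_eq_square mult_ac)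
qed

section \<open>Schwartz functions and their difference quotients\<close>

lemma partial_derivs_append: "partial_derivs (is @ js) f = partial_derivs is (partial_derivs js f)"
  by (induction "is") auto

lemma schwartz_partial_derivs: "g \<in> schwartz \<Longrightarrow> partial_derivs is g \<in> schwartz"
  unfolding schwartz_def smooth_fun_def by (simp add: partial_derivs_append[symmetric])

lemma schwartz_partial_deriv: "g \<in> schwartz \<Longrightarrow> partial_deriv i g \<in> schwartz"
  using schwartz_partial_derivs[of g "[i]"] by simp

lemma schwartz_differentiable: "g \<in> schwartz \<Longrightarrow> g differentiable (at x)"
  unfolding schwartz_def smooth_fun_def by (auto dest!: spec[where x="[]"])

lemma schwartz_isCont: "g \<in> schwartz \<Longrightarrow> isCont g x"
  by (simp add: schwartz_differentiable differentiable_imp_continuous_within)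

lemma schwartz_rapid:
  assumes "g \<in> schwartz" shows "rapid g"
proof -
  have "g \<in> borel_measurable borel"
    using assms by (intro borel_measurable_continuous_onI) (simp add: continuous_at_imp_continuous_on schwartz_isCont)
  moreover have "\<exists>C. \<forall>x. norm x ^ k * cmod (g x) \<le> C" for k
  proof -
    have "\<forall>k is. bdd_above (range (\<lambda>x. norm x ^ k * cmod (partial_derivs is g x)))"
      using assms by (simp add: schwartz_def)
    from this[rule_format, of k "[]"] show ?thesis
      by (auto simp: bdd_above_def)
  qed
  ultimately show ?thesis
    by (simp add: rapid_def)
qed

lemma schwartz_has_vector_derivative_line:
  fixes g :: "real^'n::finite \<Rightarrow> complex"
  assumes "g \<in> schwartz"
  shows "((\<lambda>u. g (x + u *\<^sub>R axis i 1)) has_vector_derivative partial_deriv i g (x + u *\<^sub>R axis i 1)) (at u)"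
proof -
  let ?D = "frechet_derivative g (at (x + u *\<^sub>R axis i 1))"
  have g: "(g has_derivative ?D) (at (x + u *\<^sub>R axis i 1))"
    using schwartz_differentiable[OF assms] by (simp add: frechet_derivative_works)
  then have "bounded_linear ?D"
    by (rule has_derivative_bounded_linear)
  then have lin: "?D (h *\<^sub>R axis i 1) = h *\<^sub>R ?D (axis i 1)" for h
    by (rule linear_cmul[OF bounded_linear.linear])
  have "((\<lambda>u. x + u *\<^sub>R axis i 1 :: real^'n) has_derivative (\<lambda>h. h *\<^sub>R axis i 1)) (at u)"
    by (auto intro!: derivative_eq_intros)
  from has_derivative_compose[OF this g]
  show ?thesis
    by (simp add: has_vector_derivative_def lin partial_deriv_def)
qed

text \<open>After division by \<open>h\<close> the majorant does not depend on the step, as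
  dominated convergence of difference quotients requires. The reason is the mean value inequality
  along the axis: the partial derivative is again a Schwartz function, hence below a multiple of
  \<open>decay\<close>.\<close>

lemma schwartz_difference_bound:
  fixes g :: "real^'n::finite \<Rightarrow> complex"
  assumes g: "g \<in> schwartz"
  obtains C where "\<And>x h. 0 < h \<Longrightarrow> h \<le> 1 \<Longrightarrow> cmod (g (x + h *\<^sub>R axis i 1) - g x) \<le> h * (C * decay x)"
proof -
  obtain C where C: "\<And>x. cmod (partial_deriv i g x) \<le> C * decay x" "C \<ge> 0"
    using rapid_le_decay[OF schwartz_rapid[OF schwartz_partial_deriv[OF g]]] by blast
  have "cmod (g (x + h *\<^sub>R axis i 1) - g x) \<le> h * ((C * 3 ^ CARD('n)) * decay x)" if h: "0 < h" "h \<le> 1" for x h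
  proof -
    let ?f = "\<lambda>u. g (x + u *\<^sub>R axis i 1)"
    let ?B = "(C * 3 ^ CARD('n)) * decay x"
    have "norm (?f h - ?f 0) \<le> (\<lambda>u. u * ?B) h - (\<lambda>u. u * ?B) 0"
    proof (rule differentiable_bound_general[OF h(1)])
      show "continuous_on {0..h} ?f"
        using schwartz_has_vector_derivative_line[OF g]
        by (intro continuous_at_imp_continuous_on) (blast intro: has_vector_derivative_continuous)
      show "continuous_on {0..h} (\<lambda>u. u * ?B)"
        by (intro continuous_intros)
      show "(?f has_vector_derivative partial_deriv i g (x + u *\<^sub>R axis i 1)) (at u)" for u
        by (rule schwartz_has_vector_derivative_line[OF g])
      show "((\<lambda>u. u * ?B) has_vector_derivative ?B) (at u)" for u
        by (auto intro!: derivative_eq_intros simp: has_real_derivative_iff_has_vector_derivative[symmetric])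
      show "norm (partial_deriv i g (x + u *\<^sub>R axis i 1)) \<le> ?B" if "0 < u" "u < h" for u
      proof -
        have "decay (x + u *\<^sub>R axis i 1) \<le> 3 ^ DIM(real^'n) * decay x"
          using that h by (intro decay_translate_le) simp
        then have "C * decay (x + u *\<^sub>R axis i 1) \<le> C * (3 ^ CARD('n) * decay x)"
          by (intro mult_left_mono C) simp
        then show ?thesis
          using C(1)[of "x + u *\<^sub>R axis i 1"] by (simp add: mult.assoc)
      qed
    qed
    then show ?thesis by simp
  qed
  then show ?thesis by (rule that)
qed

lemma has_vector_derivative_imp_tendsto:
  fixes f :: "real \<Rightarrow> 'a::real_normed_vector"
  assumes "(f has_vector_derivative D) (at 0)"
  shows "((\<lambda>h. (f h - f 0) /\<^sub>R h) \<longlongrightarrow> D) (at 0)"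
proof (rule LIM_zero_cancel, rule tendsto_norm_zero_cancel)
  have "((\<lambda>h. norm (f h - f 0 - h *\<^sub>R D) / norm h) \<longlongrightarrow> 0) (at 0)"
    using assms by (simp add: has_vector_derivative_def has_derivative_at)
  then show "((\<lambda>h. norm ((f h - f 0) /\<^sub>R h - D)) \<longlongrightarrow> 0) (at 0)"
  proof (rule Lim_transform_eventually)
    have "norm (f h - f 0 - h *\<^sub>R D) / norm h = norm ((f h - f 0) /\<^sub>R h - D)" if "h \<noteq> 0" for h
    proof -
      have "(f h - f 0) /\<^sub>R h - D = (f h - f 0 - h *\<^sub>R D) /\<^sub>R h"
        using that by (simp add: scaleR_diff_right)
      then show ?thesis
        by (simp add: divide_inverse mult.commute)
    qed
    then show "\<forall>\<^sub>F h in at 0. norm (f h - f 0 - h *\<^sub>R D) / norm h = norm ((f h - f 0) /\<^sub>R h - D)"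
      by (simp add: eventually_at_filter)
  qed
qed

section \<open>Fourier transforms of Schwartz functions\<close>

lemma integrable_cis_mult:
  fixes f :: "'a::euclidean_space \<Rightarrow> complex"
  assumes f: "integrable lborel f" and p [measurable]: "p \<in> borel_measurable borel"
  shows "integrable lborel (\<lambda>x. cis (p x) * f x)"
proof -
  have [measurable]: "f \<in> borel_measurable borel"
    using f by auto
  show ?thesis
    by (rule Bochner_Integration.integrable_bound[OF f]) (auto simp: norm_mult)
qed

text \<open>Translating \<open>g\<close> by \<open>h\<close> along a coordinate axis multiplies the transform by a
  phase; dividing by \<open>h\<close> and letting \<open>h\<close> tend to 0 replaces the integration by parts.\<close>

lemma integral_cis_partial_deriv:
  fixes g :: "real^'n::finite \<Rightarrow> complex"
  assumes g: "g \<in> schwartz"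
  shows "(\<integral>x. cis (- (x \<bullet> \<xi>)) * partial_deriv i g x \<partial>lborel) = \<i> * (\<xi> $ i) * (\<integral>x. cis (- (x \<bullet> \<xi>)) * g x \<partial>lborel)"
proof -
  let ?a = "axis i 1 :: real^'n"
  define G where "G = (\<integral>x. cis (- (x \<bullet> \<xi>)) * g x \<partial>lborel)"
  define e :: "nat \<Rightarrow> real" where "e k = inverse (real (Suc k))" for k
  have e0: "0 < e k" "e k \<le> 1" for k
    by (auto simp: e_def inverse_le_1_iff)
  have e: "e \<longlonglongrightarrow> 0"
    unfolding e_def by (rule LIMSEQ_inverse_real_of_nat)
  then have e': "filterlim e (at 0) sequentially"
    using e0 by (auto simp: filterlim_at less_imp_neq[symmetric])
  have [measurable]: "g \<in> borel_measurable borel" "partial_deriv i g \<in> borel_measurable borel"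
    using g by (auto intro!: rapid_measurable schwartz_rapid schwartz_partial_deriv)
  have gi: "integrable lborel (\<lambda>x. cis (- (x \<bullet> \<xi>)) * g x)"
    by (intro integrable_cis_mult rapid_integrable schwartz_rapid g) auto
  obtain C where C: "\<And>x h. 0 < h \<Longrightarrow> h \<le> 1 \<Longrightarrow> cmod (g (x + h *\<^sub>R ?a) - g x) \<le> h * (C * decay x)"
    using schwartz_difference_bound[OF g] by blast
  let ?D = "\<lambda>k x. cis (- (x \<bullet> \<xi>)) * ((g (x + e k *\<^sub>R ?a) - g x) /\<^sub>R e k)"
  have D: "(\<lambda>k. \<integral>x. ?D k x \<partial>lborel) \<longlonglongrightarrow> (\<integral>x. cis (- (x \<bullet> \<xi>)) * partial_deriv i g x \<partial>lborel)"
  proof (rule integral_dominated_convergence[where w="\<lambda>x. C * decay x"])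
    show "integrable lborel (\<lambda>x::real^'n. C * decay x)"
      by (intro integrable_mult_right integrable_decay)
    show "AE x in lborel. (\<lambda>k. ?D k x) \<longlonglongrightarrow> cis (- (x \<bullet> \<xi>)) * partial_deriv i g x"
    proof (intro AE_I2 tendsto_mult tendsto_const)
      fix x
      have "((\<lambda>u. g (x + u *\<^sub>R ?a)) has_vector_derivative partial_deriv i g x) (at 0)"
        using schwartz_has_vector_derivative_line[OF g, where u=0 and x=x and i=i] by simp
      then have "((\<lambda>h. (g (x + h *\<^sub>R ?a) - g x) /\<^sub>R h) \<longlongrightarrow> partial_deriv i g x) (at 0)"
        using has_vector_derivative_imp_tendsto by fastforce
      from filterlim_compose[OF this e']
      show "(\<lambda>k. (g (x + e k *\<^sub>R ?a) - g x) /\<^sub>R e k) \<longlonglongrightarrow> partial_deriv i g x" .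
    qed
    show "AE x in lborel. cmod (?D k x) \<le> C * decay x" for k
      using C[OF e0[of k]] e0(1)[of k] by (auto simp: norm_mult divide_simps mult_ac)
  qed auto
  have DG: "(\<integral>x. ?D k x \<partial>lborel) = (cis (e k * \<xi> $ i) - 1) /\<^sub>R e k * G" for k
  proof -
    \<comment> \<open>The translated point is written
      \<open>e k *\<^sub>R ?a + 1 *\<^sub>R x\<close> to match the affine change of variables with
      scale 1.\<close>
    have s: "cis (- (x \<bullet> \<xi>)) * g (x + e k *\<^sub>R ?a) = cis (e k * \<xi> $ i) * (cis (- ((e k *\<^sub>R ?a + 1 *\<^sub>R x) \<bullet> \<xi>)) * g (e k *\<^sub>R ?a + 1 *\<^sub>R x))" for x
      by (simp add: mult.assoc[symmetric] cis_mult inner_add_left inner_axis inner_commute[of ?a] add.commute)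
    have gs: "integrable lborel (\<lambda>x. cis (- (x \<bullet> \<xi>)) * g (x + e k *\<^sub>R ?a))"
      unfolding s by (intro integrable_mult_right integrable_lborel_affine[OF one_neq_zero gi])
    have "(\<integral>x. ?D k x \<partial>lborel) = (\<integral>x. (cis (- (x \<bullet> \<xi>)) * g (x + e k *\<^sub>R ?a) - cis (- (x \<bullet> \<xi>)) * g x) /\<^sub>R e k \<partial>lborel)"
      by (simp add: algebra_simps)
    also have "\<dots> = ((\<integral>x. cis (- (x \<bullet> \<xi>)) * g (x + e k *\<^sub>R ?a) \<partial>lborel) - G) /\<^sub>R e k"
      unfolding integral_scaleR_right G_def Bochner_Integration.integral_diff[OF gs gi] ..
    also have "(\<integral>x. cis (- (x \<bullet> \<xi>)) * g (x + e k *\<^sub>R ?a) \<partial>lborel) = cis (e k * \<xi> $ i) * G"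
      unfolding s integral_mult_right_zero integral_lborel_affine[OF one_neq_zero gi, of "e k *\<^sub>R ?a"] G_def by simp
    finally show ?thesis
      by (simp add: algebra_simps)
  qed
  have "(\<lambda>k. (cis (e k * \<xi> $ i) - 1) /\<^sub>R e k * G) \<longlonglongrightarrow> \<i> * (\<xi> $ i) * G"
  proof (intro tendsto_mult tendsto_const)
    have "((\<lambda>u. cis (u * \<xi> $ i)) has_vector_derivative (\<xi> $ i *\<^sub>R (\<i> * cis (0 * \<xi> $ i)))) (at 0)"
      unfolding has_vector_derivative_def by (auto intro!: derivative_eq_intros)
    then have "((\<lambda>h. (cis (h * \<xi> $ i) - 1) /\<^sub>R h) \<longlongrightarrow> \<xi> $ i *\<^sub>R \<i>) (at 0)"
      using has_vector_derivative_imp_tendsto by fastforce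
    from filterlim_compose[OF this e']
    show "(\<lambda>k. (cis (e k * \<xi> $ i) - 1) /\<^sub>R e k) \<longlonglongrightarrow> \<i> * (\<xi> $ i)"
      by (simp add: scaleR_conv_of_real mult.commute)
  qed
  with D[unfolded DG] show ?thesis
    unfolding G_def[symmetric] by (rule LIMSEQ_unique)
qed

lemma fourier_measurable:
  assumes [measurable]: "f \<in> borel_measurable borel"
  shows "fourier f \<in> borel_measurable borel"
  unfolding fourier_def[abs_def] by measurable

lemma inv_fourier_measurable:
  assumes [measurable]: "f \<in> borel_measurable borel"
  shows "inv_fourier f \<in> borel_measurable borel"
  unfolding inv_fourier_def[abs_def] by measurable

lemma fourier_partial_deriv:
  "g \<in> schwartz \<Longrightarrow> fourier (partial_deriv i g) \<xi> = \<i> * (\<xi> $ i) * fourier g \<xi>"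
  by (simp add: fourier_def integral_cis_partial_deriv)

lemma fourier_partial_derivs_replicate:
  assumes "g \<in> schwartz"
  shows "fourier (partial_derivs (replicate k i) g) \<xi> = (\<i> * (\<xi> $ i)) ^ k * fourier g \<xi>"
  using assms by (induction k) (simp_all add: fourier_partial_deriv schwartz_partial_derivs)

lemma cmod_fourier_le:
  fixes f :: "real^'n::finite \<Rightarrow> complex"
  shows "cmod (fourier f \<xi>) \<le> (2 * pi) powr (- real CARD('n) / 2) * (\<integral>x. cmod (f x) \<partial>lborel)"
proof -
  have "cmod (\<integral>x. cis (- (x \<bullet> \<xi>)) * f x \<partial>lborel) \<le> (\<integral>x. cmod (cis (- (x \<bullet> \<xi>)) * f x) \<partial>lborel)"
    by (rule integral_norm_bound)
  then show ?thesis
    unfolding fourier_def norm_mult by (intro mult_mono) auto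
qed

lemma cmod_inv_fourier_le:
  fixes f :: "real^'n::finite \<Rightarrow> complex"
  shows "cmod (inv_fourier f \<xi>) \<le> (2 * pi) powr (- real CARD('n) / 2) * (\<integral>x. cmod (f x) \<partial>lborel)"
proof -
  have "cmod (\<integral>x. cis (\<xi> \<bullet> x) * f x \<partial>lborel) \<le> (\<integral>x. cmod (cis (\<xi> \<bullet> x) * f x) \<partial>lborel)"
    by (rule integral_norm_bound)
  then show ?thesis
    unfolding inv_fourier_def norm_mult by (intro mult_mono) auto
qed

text \<open>The largest coordinate is at least the average of the absolute values. This trades a
  power of the norm for a power of one coordinate, that is, for iterated derivatives in a single
  direction.\<close>

lemma ex_coordinate_ge_norm: "\<exists>i. norm x \<le> real CARD('n) * \<bar>x $ i\<bar>" for x :: "real^'n::finite"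
proof (rule ccontr)
  assume "\<not> ?thesis"
  then have *: "real CARD('n) * \<bar>x $ i\<bar> < norm x" for i
    by (auto simp: not_le)
  have "real CARD('n) * (\<Sum>i\<in>UNIV. \<bar>x $ i\<bar>) < (\<Sum>i\<in>(UNIV::'n set). norm x)"
    unfolding sum_distrib_left by (rule sum_strict_mono) (auto simp: *)
  then have "(\<Sum>i\<in>UNIV. \<bar>x $ i\<bar>) < norm x"
    by simp
  with norm_le_l1_cart[of x] show False by simp
qed

text \<open>Up to a factor of modulus 1, the k-th power of a coordinate times the transform is the
  transform of a k-fold derivative, and so at most a constant times the L1 norm of that
  derivative.\<close>

lemma rapid_fourier:
  fixes g :: "real^'n::finite \<Rightarrow> complex"
  assumes g: "g \<in> schwartz"
  shows "rapid (fourier g)"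
  unfolding rapid_def
proof (intro conjI allI)
  show "fourier g \<in> borel_measurable borel"
    using g by (intro fourier_measurable rapid_measurable schwartz_rapid)
  fix k
  define A where "A i = (2 * pi) powr (- real CARD('n) / 2) * (\<integral>x. cmod (partial_derivs (replicate k i) g x) \<partial>lborel)" for i
  have A: "\<bar>\<xi> $ i\<bar> ^ k * cmod (fourier g \<xi>) \<le> A i" for i \<xi>
    using cmod_fourier_le[of "partial_derivs (replicate k i) g" \<xi>]
    unfolding fourier_partial_derivs_replicate[OF g] by (simp add: A_def norm_mult norm_power)
  have A0: "0 \<le> A i" for i
    by (simp add: A_def)
  have "norm \<xi> ^ k * cmod (fourier g \<xi>) \<le> real CARD('n) ^ k * (\<Sum>i\<in>UNIV. A i)" for \<xi>
  proof -
    obtain i where i: "norm \<xi> \<le> real CARD('n) * \<bar>\<xi> $ i\<bar>"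
      using ex_coordinate_ge_norm by blast
    have "norm \<xi> ^ k * cmod (fourier g \<xi>) \<le> (real CARD('n) * \<bar>\<xi> $ i\<bar>) ^ k * cmod (fourier g \<xi>)"
      by (intro mult_right_mono power_mono i) auto
    also have "\<dots> = real CARD('n) ^ k * (\<bar>\<xi> $ i\<bar> ^ k * cmod (fourier g \<xi>))"
      by (simp add: power_mult_distrib)
    also have "\<dots> \<le> real CARD('n) ^ k * A i"
      by (intro mult_left_mono A) simp
    \<comment> \<open>The index \<open>i\<close> depends on \<xi>; summing over all indices makes
      the bound uniform.\<close>
    also have "\<dots> \<le> real CARD('n) ^ k * (\<Sum>i\<in>UNIV. A i)"
      by (intro mult_left_mono member_le_sum A0) auto
    finally show ?thesis .
  qed
  then show "\<exists>C. \<forall>\<xi>. norm \<xi> ^ k * cmod (fourier g \<xi>) \<le> C"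
    by blast
qed

text \<open>Rapid decay of the transform supplies the integrability that the inversion formula
  demands. The two normalizing constants multiply to the reciprocal of
  \<open>(2 * pi) powr real CARD('n)\<close>.\<close>

lemma inv_fourier_fourier:
  fixes \<phi> :: "real^'n::finite \<Rightarrow> complex"
  assumes \<phi>: "\<phi> \<in> schwartz"
  shows "inv_fourier (fourier \<phi>) = \<phi>"
proof
  fix x
  let ?c = "(2 * pi) powr (- real CARD('n) / 2)"
  let ?F = "\<lambda>\<xi>. \<integral>y. cis (- (y \<bullet> \<xi>)) * \<phi> y \<partial>lborel"
  obtain B where B: "\<And>x. cmod (\<phi> x) \<le> B"
    using rapid_bounded[OF schwartz_rapid[OF \<phi>]] by blast
  define c where "c = complex_of_real ?c"
  have c: "c \<noteq> 0" by (simp add: c_def)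
  have "integrable lborel (\<lambda>\<xi>. inverse c * fourier \<phi> \<xi>)"
    by (intro integrable_mult_right rapid_integrable rapid_fourier \<phi>)
  also have "(\<lambda>\<xi>. inverse c * fourier \<phi> \<xi>) = ?F"
    unfolding fourier_def c_def[symmetric] mult.assoc[symmetric] using c by simp
  finally have "integrable lborel ?F" .
  from fourier_inversion_unnormalized[OF rapid_integrable[OF schwartz_rapid[OF \<phi>]] B schwartz_isCont[OF \<phi>] this]
  have *: "(\<integral>\<xi>. cis (x \<bullet> \<xi>) * ?F \<xi> \<partial>lborel) = complex_of_real ((2 * pi) powr real CARD('n)) * \<phi> x"
    by simp
  have "inv_fourier (fourier \<phi>) x = ?c * (\<integral>\<xi>. ?c * (cis (x \<bullet> \<xi>) * ?F \<xi>) \<partial>lborel)"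
    unfolding inv_fourier_def fourier_def by (simp only: mult.left_commute)
  also have "\<dots> = complex_of_real (?c * ?c * (2 * pi) powr real CARD('n)) * \<phi> x"
    unfolding integral_mult_right_zero * by simp
  also have "?c * ?c * (2 * pi) powr real CARD('n) = 1"
    by (simp only: powr_add[symmetric]) simp
  finally show "inv_fourier (fourier \<phi>) x = \<phi> x"
    by simp
qed

lemma fourier_multiplication_formula:
  fixes f g :: "real^'n::finite \<Rightarrow> complex"
  assumes f: "integrable lborel f" and g: "integrable lborel g"
  shows "(\<integral>x. f x * fourier g x \<partial>lborel) = (\<integral>\<xi>. fourier f \<xi> * g \<xi> \<partial>lborel)"
proof -
  have "(\<integral>\<xi>. (\<integral>x. cis (- (x \<bullet> \<xi>)) * f x \<partial>lborel) * g \<xi> \<partial>lborel) = (\<integral>x. f x * (\<integral>\<xi>. cis (- (x \<bullet> \<xi>)) * g \<xi> \<partial>lborel) \<partial>lborel)"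
    by (rule Fubini_bounded_kernel[OF f g]) auto
  then show ?thesis
    unfolding fourier_def by (simp add: mult.assoc mult.left_commute[of "f _"] inner_commute)
qed

lemma inv_fourier_multiplication_formula:
  fixes f g :: "real^'n::finite \<Rightarrow> complex"
  assumes f: "integrable lborel f" and g: "integrable lborel g"
  shows "(\<integral>x. inv_fourier f x * g x \<partial>lborel) = (\<integral>\<xi>. f \<xi> * inv_fourier g \<xi> \<partial>lborel)"
proof -
  have "(\<integral>x. (\<integral>\<xi>. cis (\<xi> \<bullet> x) * f \<xi> \<partial>lborel) * g x \<partial>lborel) = (\<integral>\<xi>. f \<xi> * (\<integral>x. cis (\<xi> \<bullet> x) * g x \<partial>lborel) \<partial>lborel)"
    by (rule Fubini_bounded_kernel[OF f g]) auto
  then show ?thesis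
    unfolding inv_fourier_def by (simp add: mult.assoc mult.left_commute[of "f _"] inner_commute)
qed

section \<open>Sobolev densities\<close>

lemma sobolev_density_of_schwartz:
  fixes g :: "real^'n::finite \<Rightarrow> complex"
  assumes g: "g \<in> schwartz"
  shows "sobolev_density s (distribution_of g) (fourier g)"
  unfolding sobolev_density_def distribution_fourier_def distribution_of_def
  using rapid_measurable[OF rapid_fourier[OF g]] rapid_integrable_weight[OF rapid_fourier[OF g]]
    fourier_multiplication_formula[OF rapid_integrable rapid_integrable] g schwartz_rapid by auto

text \<open>The multiplication formula moves the inverse transform from \<open>f\<close> to
  \<open>fourier \<phi>\<close>, where it cancels.\<close>

lemma sobolev_density_inv_fourier:
  fixes f :: "real^'n::finite \<Rightarrow> complex"
  assumes f: "rapid f"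
  shows "sobolev_density s (distribution_of (inv_fourier f)) f"
proof -
  have "(\<integral>x. inv_fourier f x * fourier \<phi> x \<partial>lborel) = (\<integral>\<xi>. f \<xi> * \<phi> \<xi> \<partial>lborel)" if "\<phi> \<in> schwartz" for \<phi>
    using inv_fourier_multiplication_formula[OF rapid_integrable[OF f] rapid_integrable[OF rapid_fourier[OF that]]]
    by (simp add: inv_fourier_fourier[OF that])
  then show ?thesis
    unfolding sobolev_density_def distribution_fourier_def distribution_of_def
    using rapid_measurable[OF f] rapid_integrable_weight[OF f] by simp
qed

section \<open>Gaussians as Schwartz functions\<close>

lemma real_polynomial_function_has_derivative:
  fixes p :: "real^'n::finite \<Rightarrow> real"
  assumes "real_polynomial_function p"
  shows "\<exists>p'. (\<forall>x. (p has_derivative p' x) (at x)) \<and> (\<forall>h. real_polynomial_function (\<lambda>x. p' x h))"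
  using assms
proof (induction rule: real_polynomial_function.induct)
  case (linear f)
  then show ?case
    by (intro exI[of _ "\<lambda>_. f"]) (auto simp: bounded_linear_imp_has_derivative)
next
  case (const c)
  show ?case
    by (intro exI[of _ "\<lambda>_ _. 0"]) auto
next
  case (add f g)
  then obtain f' g' where
    "\<And>x. (f has_derivative f' x) (at x)" "\<And>h. real_polynomial_function (\<lambda>x. f' x h)"
    "\<And>x. (g has_derivative g' x) (at x)" "\<And>h. real_polynomial_function (\<lambda>x. g' x h)"
    by metis
  then show ?case
    by (intro exI[of _ "\<lambda>x h. f' x h + g' x h"]) (auto intro!: derivative_intros)
next
  case (mult f g)
  then obtain f' g' where
    "\<And>x. (f has_derivative f' x) (at x)" "\<And>h. real_polynomial_function (\<lambda>x. f' x h)"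
    "\<And>x. (g has_derivative g' x) (at x)" "\<And>h. real_polynomial_function (\<lambda>x. g' x h)"
    by metis
  with mult.hyps show ?case
    by (intro exI[of _ "\<lambda>x h. f x * g' x h + f' x h * g x"] conjI allI has_derivative_mult
        real_polynomial_function.intros(3) real_polynomial_function.intros(4)) simp_all
qed

text \<open>The form \<open>(1 + norm x) ^ m\<close> suits products, where the exponents simply
  add.\<close>

lemma real_polynomial_function_growth:
  fixes p :: "'a::real_normed_vector \<Rightarrow> real"
  assumes "real_polynomial_function p"
  shows "\<exists>A m. \<forall>x. \<bar>p x\<bar> \<le> A * (1 + norm x) ^ m"
  using assms
proof (induction rule: real_polynomial_function.induct)
  case (linear f)
  then obtain K where K: "\<And>x. norm (f x) \<le> norm x * K" "K \<ge> 0"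
    using bounded_linear.nonneg_bounded by blast
  have "\<bar>f x\<bar> \<le> K * (1 + norm x) ^ 1" for x
    using K(1)[of x] K(2) by (simp add: algebra_simps)
  then show ?case by blast
next
  case (const c)
  have "\<bar>c\<bar> \<le> \<bar>c\<bar> * (1 + norm x) ^ 0" for x :: 'a by simp
  then show ?case by blast
next
  case (add f g)
  then obtain A m B n where A: "\<And>x. \<bar>f x\<bar> \<le> A * (1 + norm x) ^ m" and B: "\<And>x. \<bar>g x\<bar> \<le> B * (1 + norm x) ^ n"
    by metis
  have "\<bar>f x + g x\<bar> \<le> (\<bar>A\<bar> + \<bar>B\<bar>) * (1 + norm x) ^ (m + n)" for x
  proof -
    have "\<bar>f x + g x\<bar> \<le> \<bar>f x\<bar> + \<bar>g x\<bar>" by simp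
    also have "\<dots> \<le> A * (1 + norm x) ^ m + B * (1 + norm x) ^ n"
      by (intro add_mono A B)
    also have "\<dots> \<le> \<bar>A\<bar> * (1 + norm x) ^ (m + n) + \<bar>B\<bar> * (1 + norm x) ^ (m + n)"
      by (intro add_mono mult_mono power_increasing) auto
    finally show ?thesis by (simp add: algebra_simps)
  qed
  then show ?case by blast
next
  case (mult f g)
  then obtain A m B n where A: "\<And>x. \<bar>f x\<bar> \<le> A * (1 + norm x) ^ m" and B: "\<And>x. \<bar>g x\<bar> \<le> B * (1 + norm x) ^ n"
    by metis
  have "\<bar>f x * g x\<bar> \<le> (A * B) * (1 + norm x) ^ (m + n)" for x
  proof -
    have "\<bar>f x * g x\<bar> = \<bar>f x\<bar> * \<bar>g x\<bar>" by (rule abs_mult)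
    also have "\<dots> \<le> (A * (1 + norm x) ^ m) * (B * (1 + norm x) ^ n)"
      by (intro mult_mono A B order.trans[OF abs_ge_zero A]) auto
    finally show ?thesis by (simp add: power_add mult_ac)
  qed
  then show ?case by blast
qed

lemma real_polynomial_function_norm_squared: "real_polynomial_function (\<lambda>x::real^'n::finite. (norm (x - a))\<^sup>2)"
proof -
  have "(norm (x - a))\<^sup>2 = (\<Sum>i\<in>UNIV. (x $ i - a $ i)\<^sup>2)" for x :: "real^'n"
    unfolding norm_eq_sqrt_inner by (simp add: inner_vec_def power2_eq_square sum_nonneg)
  moreover have "real_polynomial_function (\<lambda>x::real^'n. x $ i)" for i
    by (rule real_polynomial_function.intros(1)) (rule bounded_linear_vec_nth)
  then have "real_polynomial_function (\<lambda>x::real^'n. \<Sum>i\<in>UNIV. (x $ i - a $ i)\<^sup>2)"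
    by (intro real_polynomial_function_sum real_polynomial_function_power real_polynomial_function_diff) auto
  ultimately show ?thesis by simp
qed

text \<open>For a fixed exponent \<open>q\<close>, polynomials times \<open>exp (q x)\<close> are
  closed under partial differentiation: the coefficient \<open>r\<close> turns into \<open>r\<close>
  times the derivative of \<open>q\<close> plus the derivative of \<open>r\<close>.\<close>

lemma partial_derivs_poly_exp:
  fixes p q :: "real^'n::finite \<Rightarrow> real"
  assumes p: "real_polynomial_function p" and q: "real_polynomial_function q"
  shows "\<exists>r. real_polynomial_function r \<and>
    partial_derivs is (\<lambda>x. complex_of_real (p x * exp (q x))) = (\<lambda>x. complex_of_real (r x * exp (q x)))"
proof (induction "is")
  case Nil
  then show ?case using p by auto
next
  case (Cons i "is")
  then obtain r where r: "real_polynomial_function r"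
    and e: "partial_derivs is (\<lambda>x. complex_of_real (p x * exp (q x))) = (\<lambda>x. complex_of_real (r x * exp (q x)))"
    by blast
  obtain r' where r': "\<And>x. (r has_derivative r' x) (at x)" "\<And>h. real_polynomial_function (\<lambda>x. r' x h)"
    using real_polynomial_function_has_derivative[OF r] by blast
  obtain q' where q': "\<And>x. (q has_derivative q' x) (at x)" "\<And>h. real_polynomial_function (\<lambda>x. q' x h)"
    using real_polynomial_function_has_derivative[OF q] by blast
  have "((\<lambda>x. complex_of_real (r x * exp (q x))) has_derivative
      (\<lambda>h. complex_of_real (r x * (q' x h * exp (q x)) + r' x h * exp (q x)))) (at x)" for x
    by (intro has_derivative_of_real has_derivative_mult r' has_derivative_exp q')
  then have "partial_deriv i (\<lambda>x. complex_of_real (r x * exp (q x))) x =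
      complex_of_real ((r x * q' x (axis i 1) + r' x (axis i 1)) * exp (q x))" for x
    unfolding partial_deriv_def by (subst frechet_derivative_at[symmetric]) (auto simp: algebra_simps)
  moreover have "real_polynomial_function (\<lambda>x. r x * q' x (axis i 1) + r' x (axis i 1))"
    by (intro real_polynomial_function.intros r r' q')
  ultimately show ?case
    unfolding partial_derivs.simps e by blast
qed

lemma power_mult_exp_neg_square_bounded: "\<exists>C. \<forall>r\<ge>0. (1 + r) ^ m * exp (- r\<^sup>2) \<le> (C::real)"
proof -
  have "(1 + r) ^ m * exp (- r\<^sup>2) \<le> fact m * exp 2" if "r \<ge> 0" for r :: real
  proof -
    have "(1 + r) ^ m / fact m \<le> exp (1 + r)"
    proof -
      \<comment> \<open>A single term of the exponential series is below its sum, all terms being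
        nonnegative.\<close>
      have "(\<Sum>n\<in>{m}. (1 + r) ^ n /\<^sub>R fact n) \<le> exp (1 + r)"
        unfolding exp_def using that summable_exp_generic[of "1 + r"]
        by (intro sum_le_suminf) auto
      then show ?thesis by (simp add: divide_inverse mult.commute)
    qed
    then have "(1 + r) ^ m \<le> fact m * exp (1 + r)"
      by (simp add: field_simps)
    then have "(1 + r) ^ m * exp (- r\<^sup>2) \<le> fact m * exp (1 + r) * exp (- r\<^sup>2)"
      by (intro mult_right_mono) auto
    also have "\<dots> = fact m * exp (1 + r - r\<^sup>2)"
      by (simp add: exp_add[symmetric] mult.assoc)
    also have "\<dots> \<le> fact m * exp 2"
    proof -
      have "0 \<le> (1 - r)\<^sup>2" by simp
      then have "0 \<le> 1 - 2 * r + r\<^sup>2" by (simp add: power2_diff)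
      moreover have "0 \<le> r\<^sup>2" by simp
      ultimately have "1 + r - r\<^sup>2 \<le> 2" by linarith
      then show ?thesis by simp
    qed
    finally show ?thesis .
  qed
  then show ?thesis by blast
qed

text \<open>The factor centred at the origin serves to make a density integrable; the factor centred
  at \<open>a\<close>, of arbitrary width, is the averaging kernel. The value \<open>c = 0\<close>
  leaves the first factor alone.\<close>

lemma gaussian_in_schwartz:
  fixes a :: "real^'n::finite"
  assumes c: "c \<ge> 0"
  shows "(\<lambda>x. complex_of_real (exp (- (norm x)\<^sup>2 - c * (norm (x - a))\<^sup>2))) \<in> schwartz"
proof -
  let ?q = "\<lambda>x::real^'n. - (norm x)\<^sup>2 - c * (norm (x - a))\<^sup>2"
  have q: "real_polynomial_function ?q"
    using real_polynomial_function_norm_squared[of 0] real_polynomial_function_norm_squared[of a]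
    by (intro real_polynomial_function_diff real_polynomial_function_minus real_polynomial_function.intros(4) real_polynomial_function.intros(2)) auto
  have *: "partial_derivs is (\<lambda>x. complex_of_real (exp (?q x))) differentiable (at x) \<and>
      bdd_above (range (\<lambda>x. norm x ^ k * cmod (partial_derivs is (\<lambda>x. complex_of_real (exp (?q x))) x)))" for "is" x k
  proof -
    obtain r where r: "real_polynomial_function r"
      and e: "partial_derivs is (\<lambda>x. complex_of_real (exp (?q x))) = (\<lambda>x. complex_of_real (r x * exp (?q x)))"
      using partial_derivs_poly_exp[OF real_polynomial_function.intros(2)[of 1] q, of "is"] by auto
    obtain r' where r': "\<And>x. (r has_derivative r' x) (at x)"
      using real_polynomial_function_has_derivative[OF r] by blast
    obtain q' where q': "\<And>x. (?q has_derivative q' x) (at x)"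
      using real_polynomial_function_has_derivative[OF q] by blast
    have "((\<lambda>x. complex_of_real (r x * exp (?q x))) has_derivative
      (\<lambda>h. complex_of_real (r x * (q' x h * exp (?q x)) + r' x h * exp (?q x)))) (at x)"
      by (intro has_derivative_of_real has_derivative_mult r' has_derivative_exp q')
    then have 1: "(\<lambda>x. complex_of_real (r x * exp (?q x))) differentiable (at x)"
      by (rule differentiableI)
    obtain A m where A: "\<And>x. \<bar>r x\<bar> \<le> A * (1 + norm x) ^ m"
      using real_polynomial_function_growth[OF r] by blast
    have A0: "A \<ge> 0"
      using order.trans[OF abs_ge_zero A[of 0]] by simp
    obtain C where C: "\<And>r::real. r \<ge> 0 \<Longrightarrow> (1 + r) ^ (k + m) * exp (- r\<^sup>2) \<le> C"
      using power_mult_exp_neg_square_bounded by blast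
    have "norm x ^ k * cmod (complex_of_real (r x * exp (?q x))) \<le> A * C" for x
    proof -
      have "norm x ^ k * cmod (complex_of_real (r x * exp (?q x))) = norm x ^ k * (\<bar>r x\<bar> * exp (?q x))"
        by (simp only: norm_of_real abs_mult abs_exp_cancel)
      \<comment> \<open>Since \<open>c\<close> is nonnegative, the second Gaussian factor is at most
        1; the first one alone outweighs the polynomial.\<close>
      also have "\<dots> \<le> (1 + norm x) ^ k * ((A * (1 + norm x) ^ m) * exp (- (norm x)\<^sup>2))"
        using A0 c by (intro mult_mono power_mono A) auto
      also have "\<dots> = A * ((1 + norm x) ^ (k + m) * exp (- (norm x)\<^sup>2))"
        by (simp add: power_add mult_ac)
      also have "\<dots> \<le> A * C"
        by (intro mult_left_mono C A0) simp
      finally show ?thesis .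
    qed
    then show ?thesis
      using 1 unfolding e bdd_above_def by blast
  qed
  show ?thesis
    unfolding schwartz_def smooth_fun_def mem_Collect_eq by (intro conjI allI *[THEN conjunct1] *[THEN conjunct2])
qed

section \<open>Almost everywhere uniqueness of the density\<close>

lemma weighted_L2_times_schwartz_integrable:
  fixes v \<phi> :: "real^'n::finite \<Rightarrow> complex"
  assumes v [measurable]: "v \<in> borel_measurable borel"
    and w: "integrable lborel (\<lambda>\<xi>. (1 + (norm \<xi>)\<^sup>2) powr s * (cmod (v \<xi>))\<^sup>2)"
    and \<phi>: "\<phi> \<in> schwartz"
  shows "integrable lborel (\<lambda>\<xi>. v \<xi> * \<phi> \<xi>)"
proof -
  have [measurable]: "\<phi> \<in> borel_measurable borel"
    using \<phi> by (intro rapid_measurable schwartz_rapid)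
  have i: "integrable lborel (\<lambda>\<xi>. (1 + (norm \<xi>)\<^sup>2) powr s * (cmod (v \<xi>))\<^sup>2 + (1 + (norm \<xi>)\<^sup>2) powr (- s) * (cmod (\<phi> \<xi>))\<^sup>2)"
    by (intro Bochner_Integration.integrable_add w rapid_integrable_weight schwartz_rapid \<phi>)
  show ?thesis
  proof (rule Bochner_Integration.integrable_bound[OF i])
    have "cmod (v \<xi> * \<phi> \<xi>) \<le> (1 + (norm \<xi>)\<^sup>2) powr s * (cmod (v \<xi>))\<^sup>2 + (1 + (norm \<xi>)\<^sup>2) powr (- s) * (cmod (\<phi> \<xi>))\<^sup>2" for \<xi>
    proof -
      \<comment> \<open>With \<open>b\<close> the square root of the weight, expanding the square
        below is Young's inequality with the weight on \<open>v\<close> and its reciprocal on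
        \<phi>. Both weighted squares are integrable, whatever the sign of \<open>s\<close>.\<close>
      define b where "b = (1 + (norm \<xi>)\<^sup>2) powr (s / 2)"
      have "1 + (norm \<xi>)\<^sup>2 \<noteq> 0"
        using zero_le_power2[of "norm \<xi>"] by linarith
      then have b: "b > 0"
        by (simp add: b_def)
      have 1: "(1 + (norm \<xi>)\<^sup>2) powr s = b\<^sup>2"
        unfolding b_def power2_eq_square powr_add[symmetric] by simp
      have 2: "(1 + (norm \<xi>)\<^sup>2) powr (- s) = (inverse b)\<^sup>2"
        unfolding powr_minus 1 by (simp add: power_inverse)
      have "0 \<le> (b * cmod (v \<xi>) - inverse b * cmod (\<phi> \<xi>))\<^sup>2"
        by simp
      also have "\<dots> = b\<^sup>2 * (cmod (v \<xi>))\<^sup>2 + (inverse b)\<^sup>2 * (cmod (\<phi> \<xi>))\<^sup>2 - 2 * (cmod (v \<xi>) * cmod (\<phi> \<xi>))"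
        using b by (simp add: power2_eq_square algebra_simps)
      finally have "2 * (cmod (v \<xi>) * cmod (\<phi> \<xi>)) \<le> b\<^sup>2 * (cmod (v \<xi>))\<^sup>2 + (inverse b)\<^sup>2 * (cmod (\<phi> \<xi>))\<^sup>2"
        by simp
      moreover have "0 \<le> cmod (v \<xi>) * cmod (\<phi> \<xi>)"
        by simp
      ultimately show ?thesis
        unfolding 1 2 norm_mult by linarith
    qed
    then show "AE \<xi> in lborel. cmod (v \<xi> * \<phi> \<xi>) \<le> norm ((1 + (norm \<xi>)\<^sup>2) powr s * (cmod (v \<xi>))\<^sup>2 + (1 + (norm \<xi>)\<^sup>2) powr (- s) * (cmod (\<phi> \<xi>))\<^sup>2)"
      by (intro AE_I2 order.trans[OF _ norm_ge_zero[THEN abs_of_nonneg, THEN eq_refl]]) (auto intro: order.trans[OF _ abs_ge_self])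
  qed measurable
qed

text \<open>The difference of two densities may fail to be integrable. Multiplying by the nowhere
  vanishing Gaussian \<open>?E\<close> repairs this, and a Gaussian kernel times \<open>?E\<close>
  is still an admissible test function, so all Gaussian averages of the product vanish.\<close>

lemma sobolev_density_unique:
  fixes v w :: "real^'n::finite \<Rightarrow> complex"
  assumes v: "sobolev_density s u v" and w: "sobolev_density s u w"
  shows "AE \<xi> in lborel. v \<xi> = w \<xi>"
proof -
  let ?E = "\<lambda>\<xi>::real^'n. complex_of_real (exp (- (norm \<xi>)\<^sup>2))"
  have vi: "integrable lborel (\<lambda>\<xi>. v \<xi> * \<phi> \<xi>)" and wi: "integrable lborel (\<lambda>\<xi>. w \<xi> * \<phi> \<xi>)" if "\<phi> \<in> schwartz" for \<phi>
    using v w weighted_L2_times_schwartz_integrable[OF _ _ that] unfolding sobolev_density_def by auto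
  have eq: "(\<integral>\<xi>. (v \<xi> - w \<xi>) * \<phi> \<xi> \<partial>lborel) = 0" if "\<phi> \<in> schwartz" for \<phi>
  proof -
    have "(\<integral>\<xi>. v \<xi> * \<phi> \<xi> \<partial>lborel) = (\<integral>\<xi>. w \<xi> * \<phi> \<xi> \<partial>lborel)"
      using v w that unfolding sobolev_density_def distribution_of_def by metis
    then show ?thesis
      using Bochner_Integration.integral_diff[OF vi[OF that] wi[OF that]] by (simp add: left_diff_distrib)
  qed
  have E: "?E \<in> schwartz"
    using gaussian_in_schwartz[of 0] by simp
  have i: "integrable lborel (\<lambda>\<xi>. (v \<xi> - w \<xi>) * ?E \<xi>)"
    using Bochner_Integration.integrable_diff[OF vi[OF E] wi[OF E]] by (simp add: left_diff_distrib)
  have "AE \<xi> in lborel. (v \<xi> - w \<xi>) * ?E \<xi> = 0"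
  proof (rule AE_eq_0_if_box_integrals_eq_0[OF i], rule set_integral_box_eq_0[OF i])
    fix x :: "real^'n" and c :: real assume "c > 0"
    \<comment> \<open>The coefficient \<open>inverse (2 * c\<^sup>2)\<close> is what rescaling by
      \<open>c\<close> makes of the 1/2 in the exponent of \<open>gauss\<close>.\<close>
    let ?\<phi> = "\<lambda>\<xi>. complex_of_real (exp (- (norm \<xi>)\<^sup>2 - inverse (2 * c\<^sup>2) * (norm (\<xi> - x))\<^sup>2))"
    have e: "complex_of_real (gauss ((x - \<xi>) /\<^sub>R c)) * ((v \<xi> - w \<xi>) * ?E \<xi>) = (v \<xi> - w \<xi>) * ?\<phi> \<xi>" for \<xi>
    proof -
      have "gauss ((x - \<xi>) /\<^sub>R c) * exp (- (norm \<xi>)\<^sup>2) = exp (- (norm \<xi>)\<^sup>2 - inverse (2 * c\<^sup>2) * (norm (\<xi> - x))\<^sup>2)"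
      proof -
        have "(norm ((x - \<xi>) /\<^sub>R c))\<^sup>2 = (norm (\<xi> - x))\<^sup>2 / c\<^sup>2"
          by (simp add: norm_minus_commute[of x] power_mult_distrib power_inverse divide_inverse)
        then show ?thesis
          unfolding gauss_def exp_add[symmetric] by (simp add: field_simps)
      qed
      then show ?thesis
        unfolding mult.left_commute[of _ "v \<xi> - w \<xi>"] of_real_mult[symmetric] by simp
    qed
    have "?\<phi> \<in> schwartz"
      by (rule gaussian_in_schwartz) simp
    then show "(\<integral>\<xi>. complex_of_real (gauss ((x - \<xi>) /\<^sub>R c)) * ((v \<xi> - w \<xi>) * ?E \<xi>) \<partial>lborel) = 0"
      unfolding e by (rule eq)
  qed
  then show ?thesis
    by eventually_elim simp
qed

lemma sobolev_norm_eq: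
  fixes v :: "real^'n::finite \<Rightarrow> complex"
  assumes v: "sobolev_density s u v"
  shows "sobolev_norm s u = sqrt (\<integral>\<xi>. (1 + (norm \<xi>)\<^sup>2) powr s * (cmod (v \<xi>))\<^sup>2 \<partial>lborel)"
proof -
  define w where "w = (SOME w. sobolev_density s u w)"
  have w: "sobolev_density s u w"
    unfolding w_def by (rule someI[where P="sobolev_density s u", OF v])
  have [measurable]: "v \<in> borel_measurable borel" "w \<in> borel_measurable borel"
    using v w by (auto simp: sobolev_density_def)
  have "(\<integral>\<xi>. (1 + (norm \<xi>)\<^sup>2) powr s * (cmod (w \<xi>))\<^sup>2 \<partial>lborel) = (\<integral>\<xi>. (1 + (norm \<xi>)\<^sup>2) powr s * (cmod (v \<xi>))\<^sup>2 \<partial>lborel)"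
    using sobolev_density_unique[OF w v] by (intro integral_cong_AE) (measurable, auto)
  then show ?thesis
    by (simp add: sobolev_norm_def w_def[symmetric] Let_def)
qed

text \<open>Membership in the Sobolev space includes temperedness. The inverse transform of a
  rapidly decreasing function is bounded, so this covers \<open>Lambda_op\<close>.\<close>

lemma tempered_distribution_bounded:
  fixes h :: "real^'n::finite \<Rightarrow> complex"
  assumes h [measurable]: "h \<in> borel_measurable borel" and H: "\<And>x. cmod (h x) \<le> H"
  shows "tempered_distribution (distribution_of h)"
proof -
  have i: "integrable lborel (\<lambda>x. h x * \<phi> x)" if "\<phi> \<in> schwartz" for \<phi>
    using that by (intro rapid_integrable rapid_mult_bounded[OF schwartz_rapid h H])
  have H0: "H \<ge> 0"
    using order.trans[OF norm_ge_zero H] .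
  \<comment> \<open>The seminorms without derivatives for the exponents 0 and
    \<open>2 * CARD('n)\<close> dominate a Schwartz function by \<open>decay\<close>;
    \<open>?N\<close> is the larger exponent.\<close>
  let ?N = "2 * CARD('n)"
  let ?S = "\<lambda>\<phi>. \<Sum>k\<le>?N. \<Sum>is\<in>{is::'n list. length is \<le> ?N}. schwartz_seminorm k is \<phi>"
  let ?I = "\<integral>x. decay (x::real^'n) \<partial>lborel"
  \<comment> \<open>Finiteness matters because a sum over an infinite set is 0 and would not bound
    its summands.\<close>
  have fin: "finite {is::'n list. length is \<le> ?N}"
    using finite_lists_length_le[of "UNIV::'n set" ?N] by simp
  have "cmod (distribution_of h \<phi>) \<le> (H * 2 ^ CARD('n) * 2 * ?I) * ?S \<phi>" if \<phi>: "\<phi> \<in> schwartz" for \<phi>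
  proof -
    have bdd: "bdd_above (range (\<lambda>x. norm x ^ k * cmod (partial_derivs is \<phi> x)))" for k "is"
      using \<phi> by (simp add: schwartz_def)
    have le: "norm x ^ k * cmod (partial_derivs is \<phi> x) \<le> schwartz_seminorm k is \<phi>" for k "is" x
      unfolding schwartz_seminorm_def by (rule cSUP_upper[OF _ bdd]) simp
    have nn: "0 \<le> schwartz_seminorm k is \<phi>" for k "is"
      by (rule order.trans[OF _ le[of 0]]) simp
    have S: "schwartz_seminorm k [] \<phi> \<le> ?S \<phi>" if "k \<le> ?N" for k
    proof -
      have "schwartz_seminorm k [] \<phi> \<le> (\<Sum>is\<in>{is::'n list. length is \<le> ?N}. schwartz_seminorm k is \<phi>)"
        using fin by (intro member_le_sum nn) auto
      also have "\<dots> \<le> ?S \<phi>"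
        using that by (intro member_le_sum[where f="\<lambda>k. \<Sum>is\<in>_. schwartz_seminorm k is \<phi>"] sum_nonneg nn) auto
      finally show ?thesis .
    qed
    have b: "cmod (h x * \<phi> x) \<le> (H * 2 ^ CARD('n) * 2 * ?S \<phi>) * decay x" for x
    proof -
      have "1 * cmod (\<phi> x) \<le> (decay x * (2 ^ DIM(real^'n) * (1 + norm x ^ (2 * DIM(real^'n))))) * cmod (\<phi> x)"
        by (intro mult_right_mono one_le_decay_mult) simp
      also have "\<dots> = (decay x * 2 ^ CARD('n)) * (norm x ^ 0 * cmod (partial_derivs [] \<phi> x) + norm x ^ ?N * cmod (partial_derivs [] \<phi> x))"
        by (simp add: algebra_simps)
      also have "\<dots> \<le> (decay x * 2 ^ CARD('n)) * (?S \<phi> + ?S \<phi>)"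
        using decay_pos[of x] by (intro mult_left_mono add_mono order.trans[OF le S]) auto
      finally have "cmod (\<phi> x) \<le> (2 ^ CARD('n) * 2 * ?S \<phi>) * decay x"
        by (simp add: mult_ac)
      then have "cmod (h x) * cmod (\<phi> x) \<le> H * ((2 ^ CARD('n) * 2 * ?S \<phi>) * decay x)"
        using H0 by (intro mult_mono H) auto
      then show ?thesis
        by (simp add: norm_mult mult_ac)
    qed
    have "cmod (distribution_of h \<phi>) \<le> (\<integral>x. cmod (h x * \<phi> x) \<partial>lborel)"
      unfolding distribution_of_def by (rule integral_norm_bound)
    also have "\<dots> \<le> (\<integral>x. (H * 2 ^ CARD('n) * 2 * ?S \<phi>) * decay (x::real^'n) \<partial>lborel)"
      by (intro integral_mono integrable_norm i \<phi> integrable_mult_right integrable_decay b)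
    also have "\<dots> = (H * 2 ^ CARD('n) * 2 * ?S \<phi>) * ?I"
      by (rule integral_mult_right_zero)
    finally show ?thesis
      by (simp only: mult_ac)
  qed
  then have "\<exists>B N. \<forall>\<phi>\<in>schwartz. cmod (distribution_of h \<phi>) \<le> B * (\<Sum>k\<le>N. \<Sum>is\<in>{is. length is \<le> N}. schwartz_seminorm k is \<phi>)"
    by blast
  then show ?thesis
    using i by (simp add: tempered_distribution_def distribution_of_def distrib_left mult.left_commute)
qed

section \<open>The symbol of the operator\<close>

definition Lambda_symbol :: "real \<Rightarrow> real \<Rightarrow> real^'n::finite \<Rightarrow> real" where
  "Lambda_symbol \<theta> t \<xi> = m_symbol t \<xi> * inverse (1 + (norm \<xi>)\<^sup>2) * frac_laplace_symbol \<theta> \<xi>"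

text \<open>Interpolates between \<bar>sin x\<bar> \<le> x, used for x up to 1, and \<bar>sin
  x\<bar> \<le> 1 beyond.\<close>

lemma abs_sin_le_powr:
  fixes x :: real
  assumes "0 \<le> a" "a \<le> 1" "x > 0"
  shows "\<bar>sin x\<bar> \<le> x powr a"
proof (cases "x \<le> 1")
  case True
  have "\<bar>sin x\<bar> \<le> x powr 1"
    using abs_sin_x_le_abs_x[of x] assms by simp
  also have "\<dots> \<le> x powr a"
    using True assms by (intro powr_mono') auto
  finally show ?thesis .
next
  case False
  then have "1 \<le> x powr a"
    using assms by (intro ge_one_powr_ge_zero) auto
  then show ?thesis
    using abs_sin_le_one[of x] by linarith
qed

text \<open>With R for the squared norm and S for \<open>sqrt (3 + 4 * R)\<close>, the exponent 1 -
  \<theta> in the sine estimate is the one for which the powers of R cancel: R^(-1) from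
  \<open>m_symbol\<close>, R^(1 - \<theta>) from the sine and R^\<theta> from the fractional
  Laplacian. Of S there remains S^(-\<theta>), at most 1 because S \<ge> 1. The constant 2 is the
  numerator in \<open>m_symbol\<close>.\<close>

lemma Lambda_symbol_bound:
  assumes \<theta>: "0 \<le> \<theta>" "\<theta> \<le> 1" and t: "t > 0"
  shows "\<bar>Lambda_symbol \<theta> t \<xi>\<bar> \<le> 2 * t powr (1 - \<theta>)"
proof (cases "\<xi> = 0")
  \<comment> \<open>At the origin the symbol is \<open>t\<close> for \<theta> = 0 and 0 for \<theta>
    > 0.\<close>
  case True
  then show ?thesis
    using t by (auto simp: Lambda_symbol_def m_symbol_def frac_laplace_symbol_def)
next
  case False
  define R where "R = (norm \<xi>)\<^sup>2"
  define S where "S = sqrt (3 + 4 * R)"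
  have R: "R > 0" using False by (simp add: R_def)
  have S: "S \<ge> 1" using R by (simp add: S_def)
  have frac: "frac_laplace_symbol \<theta> \<xi> = R powr \<theta>"
  proof -
    have "R powr \<theta> = norm \<xi> powr (2 * \<theta>)"
      using False by (simp add: R_def powr_powr flip: powr_numeral)
    then show ?thesis
      using R False by (simp add: frac_laplace_symbol_def)
  qed
  let ?x = "R * S * t / (2 * (1 + R))"
  have x: "?x > 0" using R S t by simp
  have x_le: "?x \<le> R * S * t"
    using R S t by (simp add: field_simps)
  let ?E = "exp (- (R * t) / (2 * (1 + R)))"
  have "Lambda_symbol \<theta> t \<xi> = ?E * (2 * (1 + R) / (R * S)) * sin ?x * inverse (1 + R) * R powr \<theta>"
    unfolding Lambda_symbol_def m_symbol_def frac R_def S_def using False by (simp only: if_False)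
  \<comment> \<open>The factor 1 + R in \<open>m_symbol\<close> cancels against the symbol of the
    inverse of I - \<Delta>.\<close>
  also have "\<dots> = ?E * (2 / (R * S)) * sin ?x * R powr \<theta>"
    using R S by (simp add: divide_simps)
  finally have "\<bar>Lambda_symbol \<theta> t \<xi>\<bar> = ?E * (2 / (R * S)) * \<bar>sin ?x\<bar> * R powr \<theta>"
    using R S by (simp add: abs_mult)
  \<comment> \<open>The exponential is at most 1, and the argument of the sine is at most
    \<open>R * S * t\<close> since its denominator is at least 1.\<close>
  also have "\<dots> \<le> 1 * (2 / (R * S)) * (R * S * t) powr (1 - \<theta>) * R powr \<theta>"
  proof (intro mult_mono)
    show "\<bar>sin ?x\<bar> \<le> (R * S * t) powr (1 - \<theta>)"
      using \<theta> x x_le by (intro order.trans[OF abs_sin_le_powr[of "1 - \<theta>"]] powr_mono2) auto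
  qed (use R S t in auto)
  also have "\<dots> = 2 * t powr (1 - \<theta>) * S powr (- \<theta>)"
    using R S t by (simp add: powr_mult powr_diff powr_minus field_simps)
  also have "\<dots> \<le> 2 * t powr (1 - \<theta>) * 1"
    using powr_mono[of "- \<theta>" 0 S] S \<theta> by (intro mult_left_mono) auto
  finally show ?thesis by simp
qed

lemma Lambda_symbol_measurable [measurable]: "Lambda_symbol \<theta> t \<in> borel_measurable borel"
  unfolding Lambda_symbol_def[abs_def] m_symbol_def frac_laplace_symbol_def by measurable

theorem corollary3p7:
  shows "\<exists>C>0. \<forall>(s::real) (\<theta>::real).
    (if CARD('n::finite) \<le> 2 then \<theta> \<in> {(2 - real CARD('n)) / 2<..1} else \<theta> \<in> {0..1}) \<longrightarrow>
    (\<forall>g \<in> (schwartz :: (real^'n \<Rightarrow> complex) set). \<forall>t>0.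
       distribution_of (Lambda_op \<theta> t g) \<in> sobolev_space s \<and>
       sobolev_norm s (distribution_of (Lambda_op \<theta> t g))
         \<le> C * t powr (1 - \<theta>) * sobolev_norm s (distribution_of g))"
\<comment> \<open>The constant is that of the symbol bound, the same for all \<open>s\<close> and
  \<theta>.\<close>
proof (intro exI[of _ 2] conjI allI impI ballI)
  fix s \<theta> t :: real and g :: "real^'n \<Rightarrow> complex"
  assume \<theta>': "if CARD('n) \<le> 2 then \<theta> \<in> {(2 - real CARD('n)) / 2<..1} else \<theta> \<in> {0..1}"
    and g: "g \<in> schwartz" and t: "t > 0"
  \<comment> \<open>The lower endpoint (2 - n)/2 is 1/2 for n = 1 and 0 for n = 2, so \<theta> is
    nonnegative in every case.\<close>
  have \<theta>: "0 \<le> \<theta>" "\<theta> \<le> 1"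
    using \<theta>' by (auto split: if_splits)
  let ?f = "\<lambda>\<xi>. complex_of_real (Lambda_symbol \<theta> t \<xi>) * fourier g \<xi>"
  let ?w = "\<lambda>\<xi>::real^'n. (1 + (norm \<xi>)\<^sup>2) powr s"
  have \<Lambda>: "Lambda_op \<theta> t g = inv_fourier ?f"
    by (simp add: Lambda_op_def fourier_multiplier_def Lambda_symbol_def[abs_def])
  have f: "rapid ?f"
    by (rule rapid_mult_bounded[OF rapid_fourier[OF g], where A="2 * t powr (1 - \<theta>)"])
       (auto simp: Lambda_symbol_bound[OF \<theta> t])
  have dens: "sobolev_density s (distribution_of (Lambda_op \<theta> t g)) ?f"
    unfolding \<Lambda> by (rule sobolev_density_inv_fourier[OF f])
  have "tempered_distribution (distribution_of (Lambda_op \<theta> t g))"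
    unfolding \<Lambda>
    by (rule tempered_distribution_bounded[OF inv_fourier_measurable[OF rapid_measurable[OF f]]
          cmod_inv_fourier_le])
  with dens show "distribution_of (Lambda_op \<theta> t g) \<in> sobolev_space s"
    unfolding sobolev_space_def by blast
  have "(\<integral>\<xi>. ?w \<xi> * (cmod (?f \<xi>))\<^sup>2 \<partial>lborel) \<le> (\<integral>\<xi>. (2 * t powr (1 - \<theta>))\<^sup>2 * (?w \<xi> * (cmod (fourier g \<xi>))\<^sup>2) \<partial>lborel)"
  proof (intro integral_mono integrable_mult_right rapid_integrable_weight f rapid_fourier g)
    fix \<xi> :: "real^'n"
    have "(cmod (?f \<xi>))\<^sup>2 \<le> (2 * t powr (1 - \<theta>) * cmod (fourier g \<xi>))\<^sup>2"
      unfolding norm_mult by (intro power_mono mult_right_mono) (auto simp: Lambda_symbol_bound[OF \<theta> t])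
    then have "?w \<xi> * (cmod (?f \<xi>))\<^sup>2 \<le> ?w \<xi> * (2 * t powr (1 - \<theta>) * cmod (fourier g \<xi>))\<^sup>2"
      by (intro mult_left_mono) auto
    then show "?w \<xi> * (cmod (?f \<xi>))\<^sup>2 \<le> (2 * t powr (1 - \<theta>))\<^sup>2 * (?w \<xi> * (cmod (fourier g \<xi>))\<^sup>2)"
      by (simp add: power_mult_distrib mult_ac)
  qed
  then have "sqrt (\<integral>\<xi>. ?w \<xi> * (cmod (?f \<xi>))\<^sup>2 \<partial>lborel) \<le> sqrt ((2 * t powr (1 - \<theta>))\<^sup>2 * (\<integral>\<xi>. ?w \<xi> * (cmod (fourier g \<xi>))\<^sup>2 \<partial>lborel))"
    by (intro real_sqrt_le_mono) simp
  also have "\<dots> = 2 * t powr (1 - \<theta>) * sqrt (\<integral>\<xi>. ?w \<xi> * (cmod (fourier g \<xi>))\<^sup>2 \<partial>lborel)"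
    by (simp add: real_sqrt_mult)
  finally show "sobolev_norm s (distribution_of (Lambda_op \<theta> t g)) \<le> 2 * t powr (1 - \<theta>) * sobolev_norm s (distribution_of g)"
    unfolding sobolev_norm_eq[OF dens] sobolev_norm_eq[OF sobolev_density_of_schwartz[OF g]] .
qed simp

end
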